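(* Let $\rho_0:\mathbb R\to[0,\infty)$ be symmetric around zero with $\rho_0(0)=0$, continuous at zero, and such that for some finite $c_0>0$, $\rho_0$ is constant on $[c_0,\infty)$ and continuous and strictly increasing on $[0,c_0]$. Let $\rho_1:\mathbb R\to[0,\infty)$ be such that for some finite $c_1>0$ it is non-decreasing on $[0,c_1]$ and constant on $[c_1,\infty)$, and $\rho_1/\sup\rho_1\le\rho_0/\sup\rho_0$. Suppose that $\theta\mapsto\mathbf V(\theta)$ is continuous on $\Theta$; that $\mathbf V(\theta)=\mathbf I_k$ for some $\theta\in\Theta$, and for every $\theta\in\Theta$ and $\alpha>0$ there is $\theta'\in\Theta$ with $\alpha\mathbf V(\theta)=\mathbf V(\theta')$; and that the pre-image under $\theta\mapsto\mathbf V(\theta)$ of every bounded set is bounded. Let $\mathcal S_n\subset\mathbb R^k\times\mathcal X$ be a collection of $n$ points $\mathbf s_i=(\mathbf y_i,\mathbf X_i)$, $i=1,\dots,n$. Let $0<b_0<\sup\rho_0$, $r_0=b_0/\sup\rho_0$, and suppose that $0<\lfloor nr_0\rfloor<n-\kappa(\mathcal S_n)$, where $\kappa(\mathcal S_n)$ is the maximal number of points of $\mathcal S_n$ lying on the same hyperplane in $\mathbb R^k\times\mathcal X$. Let $(\beta_{0,n},\theta_{0,n})$ be initial estimators for $(\beta,\theta)$, with values in $\mathbb R^q\times\Theta$. Let $(\beta_{1,n},\gamma_n)\in\mathfrak D$ satisfy $$R_n(\beta_{1,n},\mathbf V(\gamma_n))\le R_n(\beta_{0,n},\Gamma(\theta_{0,n})),$$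 and let $\theta_{1,n}$ be a solution of $\mathbf V(\theta)=\sigma_n^2\mathbf V(\gamma_n)$. Then $$\epsilon_n^*(\beta_{1,n},\gamma_n,\theta_{1,n},\mathcal S_n)\ \ge\ \min\left\{\epsilon_n^*(\beta_{0,n},\theta_{0,n},\mathcal S_n),\ \frac{\lceil nr_0\rceil}{n},\ \frac{\lceil n-nr_0\rceil-\kappa(\mathcal S_n)}{n}\right\}.$$
   Context: Fix positive integers $k,q,l$. A point $\mathbf s=(\mathbf y,\mathbf X)$ consists of $\mathbf y\in\mathbb R^k$ and a $k\times q$ matrix $\mathbf X$ with rows $\mathbf x_1^T,\dots,\mathbf x_k^T$; it is identified with $\mathbf s^T=(\mathbf y^T,\mathbf x_1^T,\dots,\mathbf x_k^T)\in\mathbb R^k\times\mathbb R^{kq}$. $\mathcal X\subset\mathbb R^{kq}$ is the subset with the lowest dimension $p=\dim(\mathcal X)\le kq$ satisfying $P(\mathbf X\in\mathcal X)=1$, where $P$ is the distribution of the observations, so that $\mathbb R^k\times\mathcal X$ has dimension $k+p$ and hyperplanes in it have dimension $k+p-1$. $\mathrm{PDS}(k)$ is the set of positive definite symmetric $k\times k$ matrices; $|\mathbf A|$ is the determinant. $\Theta\subset\mathbb R^l$ and $\mathbf V:\Theta\to\mathrm{PDS}(k)$ is a known identifiable map: $\mathbf V(\theta_1)=\mathbf V(\theta_2)$ implies $\theta_1=\theta_2$. Put $\Gamma(\theta)=\mathbf V(\theta)/|\mathbf V(\theta)|^{1/k}$ and $\mathfrak D=\{(\beta,\gamma)\in\mathbb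 R^q\times\Theta:\mathbf V(\gamma)\in\mathrm{PDS}(k),\ |\mathbf V(\gamma)|=1\}$. For any collection of $n$ points, $\sigma_n>0$ is a solution in $\sigma$ of $$\frac1n\sum_{i=1}^n\rho_0\left(\frac{\sqrt{(\mathbf y_i-\mathbf X_i\beta_{0,n})^T\Gamma(\theta_{0,n})^{-1}(\mathbf y_i-\mathbf X_i\beta_{0,n})}}{\sigma}\right)=b_0,$$ and $$R_n(\beta,\mathbf C)=\frac1n\sum_{i=1}^n\rho_1\left(\frac{\sqrt{(\mathbf y_i-\mathbf X_i\beta)^T\mathbf C^{-1}(\mathbf y_i-\mathbf X_i\beta)}}{\sigma_n}\right).$$ All estimators are functions of the collection of points, and the requirements defining $\sigma_n,\beta_{1,n},\gamma_n,\theta_{1,n}$ are imposed at $\mathcal S_n$ and at corrupted collections. Breakdown point. Corrupted collections $\mathcal S_m'$ are those obtained from $\mathcal S_n$ by replacing $m$ points by arbitrary points of $\mathbb R^k\times\mathcal X$. For a regression estimator, $$\epsilon_n^*(\beta_n,\mathcal S_n)=\min_{1\le m\le n}\left\{\frac mn:\sup_{\mathcal S_m'}\|\beta_n(\mathcal S_n)-\beta_n(\mathcal S_m')\|=\infty\right\}.$$ For an estimator $\theta_n$ with values in $\Theta$ (in particular also for $\gamma_n$), $$\epsilon_n^*(\theta_n,\mathcal S_n)=\min_{1\le m\le n}\left\{\frac mn:\sup_{\mathcal S_m'}\mathrm{dist}\big(\mathbf V(\theta_n(\mathcal S_n)),\mathbf V(\theta_n(\mathcal S_m'))\big)=\infty\right\},$$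 where $\mathrm{dist}(\mathbf A,\mathbf B)=\max\{|\lambda_1(\mathbf A)-\lambda_1(\mathbf B)|,|\lambda_k(\mathbf A)^{-1}-\lambda_k(\mathbf B)^{-1}|\}$, with $\lambda_1$ and $\lambda_k$ the largest and smallest eigenvalues. For a tuple of estimators, $\epsilon_n^*(\cdot,\mathcal S_n)$ is the smallest $m/n$ for which at least one of the components breaks down.
   Formalization: Adds that β is identifiable (Xβ=Xβ' a.s. implies β=β'), and takes sup ρ₁ > 0 and the comparison of ρ₁ with ρ₀ over [0,∞) only; without these the claim fails, e.g. for X≡(1,0), or for ρ₁ vanishing on [0,∞). *)

theory Defs
  imports "HOL-Probability.Probability"
begin

text \<open>
  A point is a pair of a response vector and a design matrix. The product of the two Euclidean
  spaces is itself a Euclidean space, which plays the role of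
  \<^term>\<open>UNIV :: (real ^ 'k) set\<close> times the space of all design matrices.
\<close>

type_synonym ('k, 'q) obs = "(real ^ 'k) \<times> (real ^ 'q ^ 'k)"

subsection \<open>Positive definite matrices\<close>

definition pds :: "real ^ 'k ^ 'k \<Rightarrow> bool" where
  "pds A \<longleftrightarrow> transpose A = A \<and> (\<forall>v. v \<noteq> 0 \<longrightarrow> v \<bullet> (A *v v) > 0)"

definition eigenvals :: "real ^ 'k ^ 'k \<Rightarrow> real set" where
  "eigenvals A = {c. \<exists>v. v \<noteq> 0 \<and> A *v v = c *\<^sub>R v}"

definition largest_eigenval :: "real ^ 'k ^ 'k \<Rightarrow> real" where
  "largest_eigenval A = Max (eigenvals A)"

definition smallest_eigenval :: "real ^ 'k ^ 'k \<Rightarrow> real" where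
  "smallest_eigenval A = Min (eigenvals A)"

definition pds_dist :: "real ^ 'k ^ 'k \<Rightarrow> real ^ 'k ^ 'k \<Rightarrow> real" where
  "pds_dist A B =
     max \<bar>largest_eigenval A - largest_eigenval B\<bar>
         \<bar>inverse (smallest_eigenval A) - inverse (smallest_eigenval B)\<bar>"

subsection \<open>Covariance structure and objective functions\<close>

definition shape :: "(real ^ 'l \<Rightarrow> real ^ 'k ^ 'k) \<Rightarrow> real ^ 'l \<Rightarrow> real ^ 'k ^ 'k" where
  "shape V \<theta> = inverse (det (V \<theta>) powr (1 / real CARD('k))) *\<^sub>R V \<theta>"

definition reg_shape_params ::
    "(real ^ 'l \<Rightarrow> real ^ 'k ^ 'k) \<Rightarrow> (real ^ 'l) set \<Rightarrow> ((real ^ 'q) \<times> (real ^ 'l)) set" where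
  "reg_shape_params V \<Theta> = {(\<beta>, \<gamma>). \<gamma> \<in> \<Theta> \<and> pds (V \<gamma>) \<and> det (V \<gamma>) = 1}"

definition mahalanobis :: "real ^ 'q \<Rightarrow> real ^ 'k ^ 'k \<Rightarrow> ('k, 'q) obs \<Rightarrow> real" where
  "mahalanobis \<beta> C s =
     sqrt ((fst s - snd s *v \<beta>) \<bullet> (matrix_inv C *v (fst s - snd s *v \<beta>)))"

definition mean_loss ::
    "(real \<Rightarrow> real) \<Rightarrow> real \<Rightarrow> ('k, 'q) obs list \<Rightarrow> real ^ 'q \<Rightarrow> real ^ 'k ^ 'k \<Rightarrow> real" where
  "mean_loss \<rho> \<sigma> S \<beta> C =
     (\<Sum>i<length S. \<rho> (mahalanobis \<beta> C (S ! i) / \<sigma>)) / real (length S)"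

text \<open>
  The set below is empty for samples that are fitted exactly at too many points.
\<close>

definition scale_solutions ::
    "(real \<Rightarrow> real) \<Rightarrow> real \<Rightarrow> real ^ 'q \<Rightarrow> real ^ 'k ^ 'k \<Rightarrow> ('k, 'q) obs list \<Rightarrow> real set" where
  "scale_solutions \<rho> b \<beta> C S = {\<sigma>. \<sigma> > 0 \<and> mean_loss \<rho> \<sigma> S \<beta> C = b}"

subsection \<open>Design space and hyperplanes\<close>

text \<open>
  Dimension means affine dimension, so that a design with an intercept column, for instance,
  is concentrated on a design space of dimension smaller than that of all matrices.
  Requiring measure 1 also makes the event measurable, since the measure of a set that is not
  measurable is 0.
\<close>

definition design_space :: "('k, 'q) obs measure \<Rightarrow> (real ^ 'q ^ 'k) set \<Rightarrow> bool" where
  "design_space P \<X> \<longleftrightarrow>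
     measure P {s \<in> space P. snd s \<in> \<X>} = 1 \<and>
     (\<forall>Z. measure P {s \<in> space P. snd s \<in> Z} = 1 \<longrightarrow> aff_dim \<X> \<le> aff_dim Z)"

text \<open>
  Hyperplanes are taken relative to the space \<open>E\<close>: they have codimension one in its affine hull.
  For \<open>E\<close> the product of the response space with a design space of dimension \<open>p\<close>, they have
  dimension \<open>k + p - 1\<close>.
\<close>

definition hyperplane_in :: "'a::euclidean_space set \<Rightarrow> 'a set \<Rightarrow> bool" where
  "hyperplane_in E H \<longleftrightarrow> affine H \<and> H \<subseteq> affine hull E \<and> aff_dim H = aff_dim E - 1"

definition kappa :: "(real ^ 'q ^ 'k) set \<Rightarrow> ('k, 'q) obs list \<Rightarrow> nat" where
  "kappa \<X> S = Max {card {i. i < length S \<and> S ! i \<in> H} | H. hyperplane_in (UNIV \<times> \<X>) H}"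

subsection \<open>Breakdown points\<close>

text \<open>
  Collections of points are lists, so that repeated points are counted with their multiplicity.
  Estimators may depend on the order of the points; those that do not are a special case.
\<close>

definition samples :: "nat \<Rightarrow> (real ^ 'q ^ 'k) set \<Rightarrow> ('k, 'q) obs list set" where
  "samples n \<X> = {S. length S = n \<and> set S \<subseteq> UNIV \<times> \<X>}"

definition corrupted ::
    "(real ^ 'q ^ 'k) set \<Rightarrow> ('k, 'q) obs list \<Rightarrow> nat \<Rightarrow> ('k, 'q) obs list set" where
  "corrupted \<X> S m =
     {S'. length S' = length S \<and>
          (\<exists>I \<subseteq> {..<length S}. card I = m \<and>
             (\<forall>i<length S. if i \<in> I then S' ! i \<in> UNIV \<times> \<X> else S' ! i = S ! i))}"

definition reg_breaks ::
    "(real ^ 'q ^ 'k) set \<Rightarrow> (('k, 'q) obs list \<Rightarrow> real ^ 'q) \<Rightarrow> ('k, 'q) obs list \<Rightarrow> nat \<Rightarrow> bool"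
  where
  "reg_breaks \<X> \<beta> S m \<longleftrightarrow> (SUP S' \<in> corrupted \<X> S m. ereal (norm (\<beta> S - \<beta> S'))) = \<infinity>"

definition cov_breaks ::
    "(real ^ 'q ^ 'k) set \<Rightarrow> (real ^ 'l \<Rightarrow> real ^ 'k ^ 'k) \<Rightarrow> (('k, 'q) obs list \<Rightarrow> real ^ 'l)
       \<Rightarrow> ('k, 'q) obs list \<Rightarrow> nat \<Rightarrow> bool" where
  "cov_breaks \<X> V \<theta> S m \<longleftrightarrow>
     (SUP S' \<in> corrupted \<X> S m. ereal (pds_dist (V (\<theta> S)) (V (\<theta> S')))) = \<infinity>"

text \<open>
  The breakdown point is a minimum over a finite set. If no amount of contamination
  causes breakdown, that set is empty and the breakdown point is infinite.
\<close>

definition breakdown_point :: "nat \<Rightarrow> (nat \<Rightarrow> bool) \<Rightarrow> ereal" where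
  "breakdown_point n breaks = Inf {ereal (real m / real n) | m. 1 \<le> m \<and> m \<le> n \<and> breaks m}"

end

theory Submission
  imports Defs
begin

text \<open>
  Let \<open>m\<close> points be replaced, where \<open>m\<close> is below all three terms of the minimum, so that
  \<open>m < n r\<^sub>0\<close>, \<open>m + \<kappa> < n - n r\<^sub>0\<close>, and the initial estimators stay bounded. All constants below
  have to be uniform over the contaminated samples.

  The geometric input is that more than \<open>\<kappa>\<close> points of the original sample have an affine hull
  containing the whole observation space (\<open>affine_hull_of_many_points\<close>), since a smaller hull would
  lie in a hyperplane. Hence such points determine every affine functional, quantitatively: there is
  a constant \<open>L\<close> such that, for every unit vector \<open>v\<close> and \<^emph>\<open>every\<close> regression parameter \<open>\<beta>\<close>, the
  strip of all \<open>(y, X)\<close> with \<open>\<bar>v \<bullet> (y - X \<beta>)\<bar> \<le> 1 / (2 L)\<close> contains at most \<open>\<kappa>\<close> of the original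
  points (\<open>direction_le_residuals\<close>). Similarly, identifiability of the regression parameter implies
  that \<open>\<beta>\<close> is bounded as soon as \<open>X \<beta>\<close> is bounded at more than \<open>\<kappa>\<close> points
  (\<open>parameter_le_fitted_values\<close>).

  The scale is a solution \<open>\<sigma>\<close> of an equation for bounded losses. More than \<open>n r\<^sub>0\<close> points of a
  contaminated sample lie outside a given strip, so solutions exist and stay away from \<open>0\<close>. Fewer
  than \<open>n r\<^sub>0\<close> points are bad and the others have bounded residuals, so \<open>\<sigma>\<close> is bounded above
  (\<open>scale_bounds\<close>).

  Since \<open>\<rho>\<^sub>1 / sup \<rho>\<^sub>1 \<le> \<rho>\<^sub>0 / sup \<rho>\<^sub>0\<close>, the improvement of the second loss forces at least
  \<open>n - n r\<^sub>0\<close> points to have Mahalanobis distance below \<open>c\<^sub>1 \<sigma>\<close>; more than \<open>\<kappa>\<close> of them are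
  original. In every direction one of these lies outside the strip, which by Cauchy--Schwarz bounds
  the quadratic form of the second covariance matrix from below. Its determinant is \<open>1\<close>, so Cramer's
  rule bounds the form from above as well. Then these points have bounded residuals, which bounds
  the second regression estimator (\<open>second_stage_bounds\<close>). Eigenvalues enter only to express
  breakdown through bounds on quadratic forms.
\<close>

section \<open>Positive definite matrices and their quadratic forms\<close>

lemma symmetric_inner_commute:
  fixes A :: "real ^ 'k ^ 'k"
  assumes "transpose A = A"
  shows "x \<bullet> (A *v y) = (A *v x) \<bullet> y"
  by (metis assms dot_lmul_matrix vector_transpose_matrix)

text \<open>
  The form of \<open>A\<close> at \<open>s x + t y\<close> is nonnegative; the choice \<open>s = - b\<close>, \<open>t = a\<close> is the usual
  discriminant argument, and for \<open>a = 0\<close> the form is affine in \<open>s\<close>, so that its slope must vanish.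
\<close>

lemma psd_cauchy_schwarz:
  fixes A :: "real ^ 'k ^ 'k"
  assumes sym: "transpose A = A" and psd: "\<And>v. 0 \<le> v \<bullet> (A *v v)"
  shows "(x \<bullet> (A *v y))\<^sup>2 \<le> (x \<bullet> (A *v x)) * (y \<bullet> (A *v y))"
proof -
  define a b c where "a = x \<bullet> (A *v x)" and "b = x \<bullet> (A *v y)" and "c = y \<bullet> (A *v y)"
  have b': "y \<bullet> (A *v x) = b"
    using symmetric_inner_commute[OF sym, of y x] by (simp add: b_def inner_commute)
  have quad: "0 \<le> s\<^sup>2 * a + 2 * s * t * b + t\<^sup>2 * c" for s t
  proof -
    have "(s *\<^sub>R x + t *\<^sub>R y) \<bullet> (A *v (s *\<^sub>R x + t *\<^sub>R y)) = s\<^sup>2 * a + 2 * s * t * b + t\<^sup>2 * c"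
      by (simp add: matrix_vector_right_distrib matrix_vector_mult_scaleR inner_add_left
          inner_add_right a_def b_def[symmetric] c_def b' power2_eq_square algebra_simps)
    with psd show ?thesis by metis
  qed
  have "0 \<le> a" "0 \<le> c" using psd by (auto simp: a_def c_def)
  show ?thesis
  proof (cases "a = 0")
    case True
    have "b = 0"
    proof (rule ccontr)
      assume "b \<noteq> 0"
      have "0 \<le> 2 * (- (c + 1) / (2 * b)) * b + c" using quad[of "- (c + 1) / (2 * b)" 1] True by simp
      also have "\<dots> = - 1" using \<open>b \<noteq> 0\<close> by (simp add: field_simps)
      finally show False by simp
    qed
    with True show ?thesis unfolding a_def[symmetric] b_def[symmetric] c_def[symmetric] by simp
  next
    case False
    have "0 \<le> a * (a * c - b\<^sup>2)"
      using quad[of "- b" a] by (simp add: power2_eq_square algebra_simps)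
    with False \<open>0 \<le> a\<close> have "0 \<le> a * c - b\<^sup>2" by (simp add: zero_le_mult_iff)
    then show ?thesis unfolding a_def[symmetric] b_def[symmetric] c_def[symmetric] by simp
  qed
qed

lemma pds_symmetric: "pds A \<Longrightarrow> transpose A = A"
  by (simp add: pds_def)

lemma pds_nonneg: "pds A \<Longrightarrow> 0 \<le> v \<bullet> (A *v v)"
  by (cases "v = 0") (auto simp: pds_def less_imp_le)

lemma pds_cauchy_schwarz:
  fixes A :: "real ^ 'k ^ 'k"
  assumes "pds A"
  shows "(x \<bullet> (A *v y))\<^sup>2 \<le> (x \<bullet> (A *v x)) * (y \<bullet> (A *v y))"
  using assms by (intro psd_cauchy_schwarz pds_symmetric pds_nonneg)

lemma pds_invertible:
  fixes A :: "real ^ 'k ^ 'k"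
  assumes "pds A"
  shows "invertible A"
proof -
  have "x = 0" if "A *v x = 0" for x
    using assms that unfolding pds_def by (metis inner_zero_right less_irrefl)
  then show ?thesis
    by (simp add: invertible_left_inverse matrix_left_invertible_ker)
qed

lemma matrix_inv_mult:
  fixes A :: "real ^ 'k ^ 'k"
  assumes "invertible A"
  shows "A ** matrix_inv A = mat 1" "matrix_inv A ** A = mat 1"
  using assms someI_ex[of "\<lambda>A'. A ** A' = mat 1 \<and> A' ** A = mat 1"]
  unfolding invertible_def matrix_inv_def by auto

lemma matrix_inv_apply:
  fixes A :: "real ^ 'k ^ 'k"
  assumes "pds A"
  shows "A *v (matrix_inv A *v x) = x" "matrix_inv A *v (A *v x) = x"
  using matrix_inv_mult[OF pds_invertible[OF assms]] by (simp_all add: matrix_vector_mul_assoc)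

lemma pds_matrix_inv:
  fixes A :: "real ^ 'k ^ 'k"
  assumes "pds A"
  shows "pds (matrix_inv A)"
proof -
  have "transpose (matrix_inv A) = matrix_inv A"
  proof -
    have "transpose (matrix_inv A) ** A = mat 1"
      using arg_cong[OF matrix_inv_mult(1)[OF pds_invertible[OF assms]], of transpose]
      by (simp add: matrix_transpose_mul pds_symmetric[OF assms] transpose_mat)
    then have "transpose (matrix_inv A) ** (A ** matrix_inv A) = matrix_inv A"
      by (simp add: matrix_mul_assoc)
    then show ?thesis by (simp add: matrix_inv_mult(1)[OF pds_invertible[OF assms]])
  qed
  moreover have "0 < v \<bullet> (matrix_inv A *v v)" if "v \<noteq> 0" for v
  proof -
    define w where "w = matrix_inv A *v v"
    have v: "v = A *v w" by (simp add: w_def matrix_inv_apply[OF assms])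
    with that have "w \<noteq> 0" by auto
    then have "0 < w \<bullet> (A *v w)" using assms by (auto simp: pds_def)
    then show ?thesis by (simp add: v[symmetric] w_def[symmetric] inner_commute)
  qed
  ultimately show ?thesis by (simp add: pds_def)
qed

text \<open>
  The weighted Cauchy--Schwarz inequality \<open>(v \<bullet> r)\<^sup>2 \<le> (v\<^sup>T A v) (r\<^sup>T A\<^sup>-\<^sup>1 r)\<close> is how
  Mahalanobis distances are compared with Euclidean ones, in every direction \<open>v\<close> separately.
\<close>

lemma inner_le_pds_forms:
  fixes A :: "real ^ 'k ^ 'k"
  assumes "pds A"
  shows "(v \<bullet> r)\<^sup>2 \<le> (v \<bullet> (A *v v)) * (r \<bullet> (matrix_inv A *v r))"
  using pds_cauchy_schwarz[OF assms, of v "matrix_inv A *v r"]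
  by (simp add: matrix_inv_apply[OF assms] inner_commute)

text \<open>
  The segment from the identity to \<open>A\<close> consists of positive definite, hence invertible, matrices, so
  the determinant has constant sign on it.
\<close>

lemma pds_det_pos:
  fixes A :: "real ^ 'k ^ 'k"
  assumes "pds A"
  shows "0 < det A"
proof (rule ccontr)
  assume "\<not> 0 < det A"
  define M where "M t = (1 - t) *\<^sub>R mat 1 + t *\<^sub>R A" for t :: real
  have "continuous_on {0..1} (\<lambda>t. det (M t))"
    unfolding M_def det_def by (intro continuous_intros)
  moreover have "det (M 1) \<le> 0" "0 \<le> det (M 0)"
    using \<open>\<not> 0 < det A\<close> by (simp_all add: M_def)
  ultimately obtain t where t: "0 \<le> t" "t \<le> 1" "det (M t) = 0"
    using IVT2'[of "\<lambda>t. det (M t)" 1 0 0] by auto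
  have "pds (M t)"
  proof -
    have "transpose (M t) = M t"
      using pds_symmetric[OF assms] by (auto simp: M_def transpose_def vec_eq_iff mat_def)
    moreover have "0 < v \<bullet> (M t *v v)" if "v \<noteq> 0" for v
    proof -
      have eq: "v \<bullet> (M t *v v) = (1 - t) * (v \<bullet> v) + t * (v \<bullet> (A *v v))"
        by (simp add: M_def matrix_vector_mult_add_rdistrib scaleR_matrix_vector_assoc[symmetric]
            inner_add_right)
      have "0 < v \<bullet> v" "0 < v \<bullet> (A *v v)" using assms that by (auto simp: pds_def)
      then show ?thesis
        unfolding eq using t by (cases "t = 0") (auto intro!: add_nonneg_pos)
    qed
    ultimately show ?thesis by (simp add: pds_def)
  qed
  then show False using t(3) pds_invertible invertible_det_nz by blast
qed

subsection \<open>Eigenvalues and quadratic forms\<close>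

text \<open>
  Finiteness is what makes \<^const>\<open>Max\<close> and \<^const>\<open>Min\<close> of the spectrum meaningful: eigenvectors
  for different eigenvalues are orthogonal, hence linearly independent.
\<close>

lemma finite_eigenvals:
  fixes A :: "real ^ 'k ^ 'k"
  assumes "transpose A = A"
  shows "finite (eigenvals A)"
proof -
  have "\<forall>c\<in>eigenvals A. \<exists>v. v \<noteq> 0 \<and> A *v v = c *\<^sub>R v" by (simp add: eigenvals_def)
  then obtain f where f: "\<And>c. c \<in> eigenvals A \<Longrightarrow> f c \<noteq> 0 \<and> A *v f c = c *\<^sub>R f c" by metis
  have orth: "f c \<bullet> f d = 0" if "c \<in> eigenvals A" "d \<in> eigenvals A" "c \<noteq> d" for c d
  proof -
    have "d * (f c \<bullet> f d) = c * (f c \<bullet> f d)"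
      using symmetric_inner_commute[OF assms, of "f c" "f d"] f[OF that(1)] f[OF that(2)] by simp
    with that show ?thesis by simp
  qed
  have "pairwise orthogonal (f ` eigenvals A)"
    unfolding pairwise_def orthogonal_def using orth by auto
  moreover have "0 \<notin> f ` eigenvals A" using f by force
  ultimately have "finite (f ` eigenvals A)"
    using pairwise_orthogonal_independent finiteI_independent by blast
  moreover have "inj_on f (eigenvals A)"
  proof (rule inj_onI, rule ccontr)
    fix c d assume *: "c \<in> eigenvals A" "d \<in> eigenvals A" "f c = f d" "c \<noteq> d"
    then have "f c \<bullet> f c = 0" using orth[of c d] by simp
    with f[OF *(1)] show False by simp
  qed
  ultimately show ?thesis by (rule finite_imageD)
qed

text \<open>
  A maximiser \<open>u\<close> of the Rayleigh quotient on the unit sphere, with value \<open>\<mu>\<close>, is an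
  eigenvector: it is a zero of the positive semidefinite form of \<open>\<mu> I - A\<close>, hence by
  Cauchy--Schwarz it lies in the kernel of \<open>\<mu> I - A\<close>.
\<close>

lemma rayleigh_maximum:
  fixes A :: "real ^ 'k ^ 'k"
  assumes sym: "transpose A = A"
  obtains \<mu> where "\<mu> \<in> eigenvals A" "\<And>v. v \<bullet> (A *v v) \<le> \<mu> * (v \<bullet> v)"
proof -
  have "continuous_on (sphere 0 1) (\<lambda>v. v \<bullet> (A *v v))"
    by (intro continuous_intros linear_continuous_on matrix_vector_mul_bounded_linear)
  moreover have "sphere (0 :: real ^ 'k) 1 \<noteq> {}" by simp
  ultimately obtain u where u: "norm u = 1"
      and mx: "\<And>w. norm w = 1 \<Longrightarrow> w \<bullet> (A *v w) \<le> u \<bullet> (A *v u)"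
    using continuous_attains_sup[OF compact_sphere, of "0 :: real ^ 'k" 1 "\<lambda>v. v \<bullet> (A *v v)"] by auto
  define \<mu> where "\<mu> = u \<bullet> (A *v u)"
  have le: "v \<bullet> (A *v v) \<le> \<mu> * (v \<bullet> v)" for v
  proof (cases "v = 0")
    case False
    have "(sgn v) \<bullet> (A *v (sgn v)) \<le> \<mu>"
      unfolding \<mu>_def using False by (intro mx) (simp add: norm_sgn)
    then have "(v \<bullet> (A *v v)) / (norm v * norm v) \<le> \<mu>"
      by (simp add: sgn_div_norm matrix_vector_mult_scaleR field_simps)
    then show ?thesis using False
      by (simp add: pos_divide_le_eq dot_square_norm power2_eq_square)
  qed simp
  define B where "B = \<mu> *\<^sub>R mat 1 - A"
  have Bv: "B *v v = \<mu> *\<^sub>R v - A *v v" for v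
    by (simp add: B_def matrix_vector_mult_diff_rdistrib scaleR_matrix_vector_assoc[symmetric])
  have "transpose B = B" using sym by (auto simp: B_def transpose_def vec_eq_iff mat_def)
  moreover have "0 \<le> v \<bullet> (B *v v)" for v using le[of v] by (simp add: Bv inner_diff_right)
  ultimately have "((B *v u) \<bullet> (B *v u))\<^sup>2 \<le> ((B *v u) \<bullet> (B *v (B *v u))) * (u \<bullet> (B *v u))"
    by (rule psd_cauchy_schwarz)
  also have "u \<bullet> (B *v u) = 0" using u by (simp add: Bv inner_diff_right \<mu>_def dot_square_norm)
  finally have "B *v u = 0" by simp
  then have "A *v u = \<mu> *\<^sub>R u" by (simp add: Bv)
  then have "\<mu> \<in> eigenvals A" using u by (auto simp: eigenvals_def intro!: exI[of _ u])
  with le that show thesis by blast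
qed

text \<open>
  In terms of the Loewner order, \<open>a I \<le> A \<le> b I\<close>.
\<close>

definition form_between :: "real \<Rightarrow> real \<Rightarrow> real ^ 'k ^ 'k \<Rightarrow> bool" where
  "form_between a b A \<longleftrightarrow> (\<forall>v. a * (v \<bullet> v) \<le> v \<bullet> (A *v v) \<and> v \<bullet> (A *v v) \<le> b * (v \<bullet> v))"

lemma form_between_mono:
  fixes A :: "real ^ 'k ^ 'k"
  assumes "form_between a b A" "a' \<le> a" "b \<le> b'"
  shows "form_between a' b' A"
  using assms unfolding form_between_def
  by (meson inner_ge_zero mult_right_mono order_trans)

lemma pds_scaleR:
  assumes "pds A" "0 < s"
  shows "pds (s *\<^sub>R A)"
  using assms by (auto simp: pds_def transpose_def vec_eq_iff scaleR_matrix_vector_assoc[symmetric])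

lemma form_between_scaleR:
  assumes "form_between a A C" "0 < a" "0 < lo" "lo \<le> s" "s \<le> hi"
  shows "form_between (lo * a) (hi * A) (s *\<^sub>R C)"
  unfolding form_between_def
proof (intro allI conjI)
  fix v
  have f: "a * (v \<bullet> v) \<le> v \<bullet> (C *v v)" "v \<bullet> (C *v v) \<le> A * (v \<bullet> v)"
    using assms(1) by (auto simp: form_between_def)
  have nn: "0 \<le> a * (v \<bullet> v)" using assms(2) by simp
  have "lo * (a * (v \<bullet> v)) \<le> s * (v \<bullet> (C *v v))" using assms f nn by (intro mult_mono) auto
  then show "lo * a * (v \<bullet> v) \<le> v \<bullet> ((s *\<^sub>R C) *v v)"
    by (simp add: scaleR_matrix_vector_assoc[symmetric] mult.assoc)
  have "s * (v \<bullet> (C *v v)) \<le> hi * (A * (v \<bullet> v))"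
    using assms f(2) order_trans[OF nn f(1)] by (intro mult_mono) auto
  then show "v \<bullet> ((s *\<^sub>R C) *v v) \<le> hi * A * (v \<bullet> v)"
    by (simp add: scaleR_matrix_vector_assoc[symmetric] mult.assoc)
qed

lemma form_between_unit_sphere:
  fixes A :: "real ^ 'k ^ 'k"
  assumes "\<And>v. norm v = 1 \<Longrightarrow> a \<le> v \<bullet> (A *v v) \<and> v \<bullet> (A *v v) \<le> b"
  shows "form_between a b A"
  unfolding form_between_def
proof
  fix v :: "real ^ 'k"
  show "a * (v \<bullet> v) \<le> v \<bullet> (A *v v) \<and> v \<bullet> (A *v v) \<le> b * (v \<bullet> v)"
  proof (cases "v = 0")
    case False
    have "a \<le> (v \<bullet> (A *v v)) / (norm v * norm v) \<and> (v \<bullet> (A *v v)) / (norm v * norm v) \<le> b"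
      using assms[of "sgn v"] False
      by (simp add: norm_sgn sgn_div_norm matrix_vector_mult_scaleR field_simps)
    then show ?thesis using False
      by (simp add: pos_divide_le_eq pos_le_divide_eq dot_square_norm power2_eq_square)
  qed simp
qed

lemma form_between_extreme_eigenvals:
  fixes A :: "real ^ 'k ^ 'k"
  assumes sym: "transpose A = A"
  shows "form_between (smallest_eigenval A) (largest_eigenval A) A"
proof -
  obtain \<mu> where \<mu>: "\<mu> \<in> eigenvals A" "\<And>v. v \<bullet> (A *v v) \<le> \<mu> * (v \<bullet> v)"
    using rayleigh_maximum[OF sym] by metis
  have symn: "transpose (- A) = - A" using sym by (auto simp: transpose_def vec_eq_iff)
  have An: "(- A) *v v = - (A *v v)" for v
    using matrix_vector_mult_add_rdistrib[of A "- A" v] by (simp add: eq_neg_iff_add_eq_0 add.commute)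
  obtain \<nu> where \<nu>: "\<nu> \<in> eigenvals (- A)" "\<And>v. v \<bullet> ((- A) *v v) \<le> \<nu> * (v \<bullet> v)"
    using rayleigh_maximum[OF symn] by metis
  have "- \<nu> \<in> eigenvals A"
  proof -
    obtain w where w: "w \<noteq> 0" "- (A *v w) = \<nu> *\<^sub>R w"
      using \<nu>(1) by (auto simp: eigenvals_def An)
    then have "A *v w = (- \<nu>) *\<^sub>R w" by (metis minus_minus scaleR_minus_left)
    with w(1) show ?thesis by (auto simp: eigenvals_def)
  qed
  then have "smallest_eigenval A \<le> - \<nu>" "\<mu> \<le> largest_eigenval A"
    using \<mu>(1) finite_eigenvals[OF sym] by (auto simp: smallest_eigenval_def largest_eigenval_def)
  moreover have "form_between (- \<nu>) \<mu> A"
    unfolding form_between_def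
  proof
    fix v
    show "- \<nu> * (v \<bullet> v) \<le> v \<bullet> (A *v v) \<and> v \<bullet> (A *v v) \<le> \<mu> * (v \<bullet> v)"
      using \<mu>(2)[of v] \<nu>(2)[of v] by (simp add: An)
  qed
  ultimately show ?thesis by (metis form_between_mono)
qed

lemma eigenvals_form_between:
  fixes A :: "real ^ 'k ^ 'k"
  assumes "form_between a b A" "c \<in> eigenvals A"
  shows "a \<le> c \<and> c \<le> b"
proof -
  obtain v where v: "v \<noteq> 0" "A *v v = c *\<^sub>R v" using assms(2) by (auto simp: eigenvals_def)
  then have "0 < v \<bullet> v" by simp
  moreover have "a * (v \<bullet> v) \<le> c * (v \<bullet> v)" "c * (v \<bullet> v) \<le> b * (v \<bullet> v)"
    using assms(1)[unfolded form_between_def, rule_format, of v] by (simp_all add: v(2))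
  ultimately show ?thesis by simp
qed

lemma extreme_eigenvals_in:
  fixes A :: "real ^ 'k ^ 'k"
  assumes sym: "transpose A = A"
  shows "smallest_eigenval A \<in> eigenvals A" "largest_eigenval A \<in> eigenvals A"
proof -
  have "eigenvals A \<noteq> {}" using rayleigh_maximum[OF sym] by blast
  then show "smallest_eigenval A \<in> eigenvals A" "largest_eigenval A \<in> eigenvals A"
    unfolding smallest_eigenval_def largest_eigenval_def
    by (intro Min_in Max_in finite_eigenvals[OF sym]; assumption)+
qed

lemma pds_smallest_eigenval_pos:
  fixes A :: "real ^ 'k ^ 'k"
  assumes "pds A"
  shows "0 < smallest_eigenval A"
proof -
  obtain v where v: "v \<noteq> 0" "A *v v = smallest_eigenval A *\<^sub>R v"
    using extreme_eigenvals_in(1)[OF pds_symmetric[OF assms]] unfolding eigenvals_def by blast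
  then have "0 < v \<bullet> (A *v v)" using assms by (auto simp: pds_def)
  then have "0 < smallest_eigenval A * (v \<bullet> v)" by (simp add: v(2))
  then show ?thesis
    using mult_nonpos_nonneg[of "smallest_eigenval A" "v \<bullet> v"] by (cases "smallest_eigenval A \<le> 0") auto
qed

text \<open>
  Distances to a fixed positive definite matrix are bounded on a family of positive definite
  matrices exactly when the quadratic forms of the family have common positive bounds; this
  translates breakdown of covariance estimators into quadratic forms.
\<close>

lemma form_between_of_pds_dist:
  fixes A B :: "real ^ 'k ^ 'k"
  assumes "pds A" "pds B" "pds_dist A B \<le> K"
  shows "form_between (inverse (inverse (smallest_eigenval A) + K)) (largest_eigenval A + K) B"
proof -
  have 1: "\<bar>largest_eigenval A - largest_eigenval B\<bar> \<le> K"
    and 2: "\<bar>inverse (smallest_eigenval A) - inverse (smallest_eigenval B)\<bar> \<le> K"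
    using assms(3) by (auto simp: pds_dist_def)
  have "inverse (smallest_eigenval B) \<le> inverse (smallest_eigenval A) + K" using 2 by linarith
  then have "inverse (inverse (smallest_eigenval A) + K) \<le> inverse (inverse (smallest_eigenval B))"
    using pds_smallest_eigenval_pos[OF assms(2)] by (intro le_imp_inverse_le) auto
  moreover have "largest_eigenval B \<le> largest_eigenval A + K" using 1 by linarith
  ultimately show ?thesis
    using form_between_mono[OF form_between_extreme_eigenvals[OF pds_symmetric[OF assms(2)]]] by simp
qed

lemma pds_dist_of_form_between:
  fixes A B :: "real ^ 'k ^ 'k"
  assumes "pds B" "form_between a b B" "0 < a"
  shows "pds_dist A B \<le> \<bar>largest_eigenval A\<bar> + \<bar>b\<bar> + \<bar>inverse (smallest_eigenval A)\<bar> + inverse a"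
proof -
  have *: "a \<le> smallest_eigenval B" "a \<le> largest_eigenval B" "largest_eigenval B \<le> b"
    using eigenvals_form_between[OF assms(2)] extreme_eigenvals_in[OF pds_symmetric[OF assms(1)]]
    by auto
  then have "inverse (smallest_eigenval B) \<le> inverse a" "0 \<le> inverse (smallest_eigenval B)"
    using assms(3) by (auto intro: le_imp_inverse_le)
  moreover have "\<bar>x - y\<bar> \<le> \<bar>x\<bar> + \<bar>y\<bar>" for x y :: real by (rule abs_triangle_ineq4)
  ultimately show ?thesis using * assms(3) unfolding pds_dist_def by (intro max.boundedI) linarith+
qed

subsection \<open>Determinants\<close>

lemma abs_det_le:
  fixes A :: "real ^ 'k ^ 'k"
  assumes "\<And>i j. \<bar>A $ i $ j\<bar> \<le> c"
  shows "\<bar>det A\<bar> \<le> fact CARD('k) * c ^ CARD('k)"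
proof -
  have "\<bar>det A\<bar> \<le> (\<Sum>p | p permutes (UNIV :: 'k set). \<bar>of_int (sign p) * (\<Prod>i\<in>UNIV. A $ i $ p i)\<bar>)"
    unfolding det_def by (rule sum_abs)
  also have "\<dots> \<le> (\<Sum>p | p permutes (UNIV :: 'k set). c ^ CARD('k))"
  proof (rule sum_mono)
    fix p :: "'k \<Rightarrow> 'k"
    have "\<bar>of_int (sign p) * (\<Prod>i\<in>UNIV. A $ i $ p i)\<bar> = (\<Prod>i\<in>UNIV. \<bar>A $ i $ p i\<bar>)"
      by (simp add: abs_mult abs_prod sign_def)
    also have "\<dots> \<le> (\<Prod>i\<in>(UNIV :: 'k set). c)" by (intro prod_mono) (simp add: assms)
    finally show "\<bar>of_int (sign p) * (\<Prod>i\<in>UNIV. A $ i $ p i)\<bar> \<le> c ^ CARD('k)" by simp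
  qed
  also have "\<dots> = fact CARD('k) * c ^ CARD('k)"
    using card_permutations[of "UNIV :: 'k set" "CARD('k)"] by simp
  finally show ?thesis .
qed

lemma pds_entry_le:
  fixes A :: "real ^ 'k ^ 'k"
  assumes "pds A" "\<And>v. v \<bullet> (A *v v) \<le> b * (v \<bullet> v)"
  shows "\<bar>A $ i $ j\<bar> \<le> b"
proof -
  have e: "A $ i $ j = axis i 1 \<bullet> (A *v axis j 1)" for i j
    by (simp add: inner_axis' matrix_vector_mult_basis column_def)
  have d: "axis i 1 \<bullet> (A *v axis i 1) \<le> b" for i
    using assms(2)[of "axis i 1"] by (simp add: inner_axis_axis)
  have nn: "0 \<le> axis i 1 \<bullet> (A *v axis i 1)" for i using pds_nonneg[OF assms(1)] .
  have "\<bar>A $ i $ j\<bar>\<^sup>2 \<le> (axis i 1 \<bullet> (A *v axis i 1)) * (axis j 1 \<bullet> (A *v axis j 1))"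
    using pds_cauchy_schwarz[OF assms(1), of "axis i 1" "axis j 1"] by (simp add: e)
  also have "\<dots> \<le> b * b" using d nn by (intro mult_mono) (auto intro: order_trans)
  finally show ?thesis
    using order_trans[OF nn d] by (auto simp: power2_eq_square[symmetric] intro: power2_le_imp_le)
qed

text \<open>
  With \<open>w = A\<^sup>-\<^sup>1 r\<close> one has \<open>a \<parallel>w\<parallel>\<^sup>2 \<le> w \<bullet> A w = w \<bullet> r \<le> \<parallel>w\<parallel> \<parallel>r\<parallel>\<close>, so \<open>\<parallel>w\<parallel> \<le> \<parallel>r\<parallel> / a\<close>.
\<close>

lemma matrix_inv_form_le:
  fixes A :: "real ^ 'k ^ 'k"
  assumes "pds A" "form_between a b A" "0 < a"
  shows "r \<bullet> (matrix_inv A *v r) \<le> inverse a * (r \<bullet> r)"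
proof -
  define w where "w = matrix_inv A *v r"
  have r: "r = A *v w" by (simp add: w_def matrix_inv_apply[OF assms(1)])
  have "a * (norm w * norm w) \<le> r \<bullet> w"
    using assms(2) by (simp add: form_between_def r inner_commute dot_square_norm
        power2_eq_square[symmetric])
  also have rw: "r \<bullet> w \<le> norm r * norm w" by (rule norm_cauchy_schwarz)
  finally have "a * norm w \<le> norm r"
    by (cases "norm w = 0") (auto simp: mult.assoc[symmetric])
  then have "norm w \<le> inverse a * norm r" using assms(3) by (simp add: field_simps)
  then have "norm r * norm w \<le> inverse a * (norm r * norm r)"
    by (metis mult.left_commute mult_left_mono norm_ge_zero)
  with rw show ?thesis unfolding w_def by (simp add: dot_square_norm power2_eq_square)
qed

text \<open>
  By Cramer's rule the coordinates of \<open>A v\<close>, for a unit vector \<open>v\<close>, are determinants of matrices whose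
  entries are entries of \<open>A\<^sup>-\<^sup>1\<close> or coordinates of \<open>v\<close>; a lower bound on the form of \<open>A\<close> bounds the
  former.
\<close>

lemma form_upper_bound_of_det_one:
  fixes A :: "real ^ 'k ^ 'k"
  assumes "pds A" "det A = 1" "0 < a" "\<And>v. norm v = 1 \<Longrightarrow> a \<le> v \<bullet> (A *v v)"
  shows "form_between a (real CARD('k) * (fact CARD('k) * (max (inverse a) 1) ^ CARD('k))) A"
proof (rule form_between_unit_sphere, intro conjI)
  fix v :: "real ^ 'k" assume v: "norm v = 1"
  show "a \<le> v \<bullet> (A *v v)" by (rule assms(4)[OF v])
  define M where "M = matrix_inv A"
  define c where "c = max (inverse a) 1"
  define x where "x = A *v v"
  \<comment> \<open>the upper bound depends on \<open>A\<close>; the uniform one is the conclusion\<close>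
  have lower: "form_between a (largest_eigenval A) A"
  proof (rule form_between_unit_sphere)
    fix w :: "real ^ 'k" assume "norm w = 1"
    then show "a \<le> w \<bullet> (A *v w) \<and> w \<bullet> (A *v w) \<le> largest_eigenval A"
      using assms(4)[of w] form_between_extreme_eigenvals[OF pds_symmetric[OF assms(1)]]
      by (metis dot_square_norm form_between_def mult.right_neutral one_power2)
  qed
  have "det M * det A = 1"
    unfolding M_def using matrix_inv_mult(2)[OF pds_invertible[OF assms(1)]]
    by (metis det_I det_mul)
  then have detM: "det M = 1" by (simp add: assms(2))
  have "M *v x = v" by (simp add: M_def x_def matrix_inv_apply[OF assms(1)])
  then have x: "x = (\<chi> k. det (\<chi> i j. if j = k then v $ i else M $ i $ j) / det M)"
    using cramer[of M x v] detM by simp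
  have "\<bar>M $ i $ j\<bar> \<le> c" for i j
    using pds_entry_le[OF pds_matrix_inv[OF assms(1)], of "inverse a" i j]
      matrix_inv_form_le[OF assms(1) lower assms(3)]
    unfolding M_def c_def by (simp add: le_max_iff_disj)
  moreover have "\<bar>v $ i\<bar> \<le> c" for i
    using component_le_norm_cart[of v i] v by (simp add: c_def le_max_iff_disj)
  ultimately have "\<bar>x $ k\<bar> \<le> fact CARD('k) * c ^ CARD('k)" for k
    unfolding x by (simp add: detM) (intro abs_det_le, simp)
  then have "(\<Sum>k\<in>UNIV. \<bar>x $ k\<bar>) \<le> (\<Sum>k\<in>(UNIV :: 'k set). fact CARD('k) * c ^ CARD('k))"
    by (rule sum_mono)
  then have "norm x \<le> real CARD('k) * (fact CARD('k) * c ^ CARD('k))"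
    using norm_le_l1_cart[of x] by simp
  moreover have "v \<bullet> x \<le> norm x" using norm_cauchy_schwarz[of v x] v by simp
  ultimately show "v \<bullet> (A *v v) \<le> real CARD('k) * (fact CARD('k) * max (inverse a) 1 ^ CARD('k))"
    unfolding x_def c_def by linarith
qed

text \<open>
  The normalisation to determinant one is harmless on families with common bounds: the determinant
  is bounded above through the entries of \<open>A\<close>, and away from zero through those of \<open>A\<^sup>-\<^sup>1\<close>.
\<close>

lemma form_between_scale_det:
  fixes A :: "real ^ 'k ^ 'k"
  assumes "0 < a"
  obtains a' b' where "0 < a'"
    "\<And>A :: real ^ 'k ^ 'k. pds A \<Longrightarrow> form_between a b A \<Longrightarrow>
       form_between a' b' (inverse (det A powr (1 / real CARD('k))) *\<^sub>R A)"
proof -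
  let ?p = "1 / real CARD('k)"
  define d where "d = inverse (fact CARD('k) * inverse a ^ CARD('k))"
  define D where "D = max 1 (fact CARD('k) * b ^ CARD('k))"
  have "0 < d" using assms by (simp add: d_def)
  show thesis
  proof (rule that)
    show "0 < inverse (D powr ?p) * a" using assms by (simp add: D_def)
    fix A :: "real ^ 'k ^ 'k" assume A: "pds A" "form_between a b A"
    define s where "s = inverse (det A powr ?p)"
    have pos: "0 < det A" by (rule pds_det_pos[OF A(1)])
    have "\<bar>A $ i $ j\<bar> \<le> b" for i j
      using A(2) by (intro pds_entry_le[OF A(1)]) (simp add: form_between_def)
    then have upper: "det A \<le> D" using abs_det_le[of A b] pos by (simp add: D_def)
    have "\<bar>matrix_inv A $ i $ j\<bar> \<le> inverse a" for i j
      by (intro pds_entry_le pds_matrix_inv matrix_inv_form_le[OF _ A(2)] A assms)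
    then have "det (matrix_inv A) \<le> inverse d"
      using abs_det_le[of "matrix_inv A" "inverse a"] by (simp add: d_def)
    moreover have "det (matrix_inv A) * det A = 1"
      using matrix_inv_mult(2)[OF pds_invertible[OF A(1)]] by (metis det_I det_mul)
    then have "det (matrix_inv A) = inverse (det A)" using inverse_unique[of "det A" "det (matrix_inv A)"] by (simp add: mult.commute)
    ultimately have lower: "d \<le> det A" using \<open>0 < d\<close> pos by simp
    have s: "inverse (D powr ?p) \<le> s" "s \<le> inverse (d powr ?p)" "0 < s"
      unfolding s_def using lower upper pos \<open>0 < d\<close>
      by (auto intro!: le_imp_inverse_le powr_mono2)
    show "form_between (inverse (D powr ?p) * a) (inverse (d powr ?p) * b)
        (inverse (det A powr ?p) *\<^sub>R A)"
      unfolding s_def[symmetric] using A(2) assms s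
      by (intro form_between_scaleR) (auto simp: D_def)
  qed
qed

section \<open>Points outside every hyperplane\<close>

lemma kappa_ge:
  assumes "hyperplane_in (UNIV \<times> \<X>) H"
  shows "card {i. i < length S \<and> S ! i \<in> H} \<le> kappa \<X> S"
  unfolding kappa_def
proof (rule Max_ge)
  have le: "card {i. i < length S \<and> S ! i \<in> H} \<le> length S" for H
    using card_mono[OF finite_lessThan, of "{i. i < length S \<and> S ! i \<in> H}" "length S"]
    by (simp add: subset_eq)
  have "{card {i. i < length S \<and> S ! i \<in> H} | H. hyperplane_in (UNIV \<times> \<X>) H} \<subseteq> {..length S}"
    using le by blast
  then show "finite {card {i. i < length S \<and> S ! i \<in> H} | H. hyperplane_in (UNIV \<times> \<X>) H}"
    by (rule finite_subset) simp
qed (use assms in blast)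

text \<open>
  An affine basis of the hull of \<open>T\<close> extends to one of the hull of \<open>E\<close> by at least one further point;
  removing that point leaves the basis of a hyperplane.
\<close>

lemma hyperplane_containing:
  fixes E T :: "'a::euclidean_space set"
  assumes "T \<subseteq> affine hull E" "\<not> E \<subseteq> affine hull T"
  obtains H where "hyperplane_in E H" "T \<subseteq> H"
proof -
  obtain B where B: "B \<subseteq> T" "\<not> affine_dependent B" "affine hull T = affine hull B"
    using affine_basis_exists by blast
  have "B \<subseteq> affine hull E" using B(1) assms(1) by blast
  then obtain B' where B': "\<not> affine_dependent B'" "B \<subseteq> B'" "B' \<subseteq> affine hull E"
      "affine hull B' = affine hull (affine hull E)"
    using extend_to_affine_basis[OF B(2), of "affine hull E"] by metis
  then have hull: "affine hull B' = affine hull E" by simp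
  have "B' \<noteq> B" using assms(2) B(3) hull hull_subset[of E affine] by auto
  then obtain x where x: "x \<in> B'" "x \<notin> B" using B'(2) by blast
  have fin: "finite B'" by (rule aff_independent_finite[OF B'(1)])
  have ind: "\<not> affine_dependent (B' - {x})"
    by (rule affine_independent_subset[OF B'(1)]) simp
  have "aff_dim E = int (card B') - 1"
    using aff_dim_affine_independent[OF B'(1)] aff_dim_affine_hull[of B'] aff_dim_affine_hull[of E]
    by (simp add: hull)
  moreover have "int (card B') = int (card (B' - {x})) + 1"
    using card.remove[OF fin x(1)] by simp
  then have "aff_dim (affine hull (B' - {x})) = int (card B') - 1 - 1"
    using aff_dim_affine_independent[OF ind] by simp
  moreover have "affine hull (B' - {x}) \<subseteq> affine hull E"
    unfolding hull[symmetric] by (intro hull_mono) auto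
  ultimately have "hyperplane_in E (affine hull (B' - {x}))"
    by (simp add: hyperplane_in_def affine_affine_hull)
  moreover have "T \<subseteq> affine hull (B' - {x})"
  proof -
    have "T \<subseteq> affine hull B" using B(3) hull_subset[of T affine] by simp
    also have "\<dots> \<subseteq> affine hull (B' - {x})" using x B'(2) by (intro hull_mono) auto
    finally show ?thesis .
  qed
  ultimately show thesis by (rule that)
qed

text \<open>
  Otherwise the chosen points would lie on a common hyperplane, and there are too many of them.
\<close>

lemma affine_hull_of_many_points:
  fixes S :: "('k::finite, 'q::finite) obs list"
  assumes "set S \<subseteq> UNIV \<times> \<X>" "J \<subseteq> {..<length S}" "kappa \<X> S < card J"
  shows "UNIV \<times> \<X> \<subseteq> affine hull ((!) S ` J)"
proof (rule ccontr)
  assume *: "\<not> UNIV \<times> \<X> \<subseteq> affine hull ((!) S ` J)"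
  have "(!) S ` J \<subseteq> set S" using assms(2) by (auto intro: nth_mem)
  then have "(!) S ` J \<subseteq> UNIV \<times> \<X>" using assms(1) by (rule subset_trans)
  then have "(!) S ` J \<subseteq> affine hull (UNIV \<times> \<X>)" by (rule subset_trans[OF _ hull_subset])
  then obtain H where H: "hyperplane_in (UNIV \<times> \<X>) H" "(!) S ` J \<subseteq> H"
    using hyperplane_containing[OF _ *] by metis
  have "card J \<le> card {i. i < length S \<and> S ! i \<in> H}"
    using H(2) assms(2) by (intro card_mono) auto
  with kappa_ge[OF H(1), of S] assms(3) show False by simp
qed

text \<open>
  The constant depends on \<open>x\<close> and \<open>T\<close> only: it is the sum of the absolute coefficients in some
  representation of \<open>x\<close> as a linear combination. This uniformity in \<open>f\<close> replaces compactness
  arguments for functionals that range over an unbounded set.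
\<close>

lemma linear_functional_le_on_span:
  fixes T :: "'a::real_vector set"
  assumes "x \<in> span T"
  shows "\<exists>L\<ge>0. \<forall>f :: 'a \<Rightarrow> real. \<forall>\<delta>. linear f \<longrightarrow> (\<forall>t\<in>T. \<bar>f t\<bar> \<le> \<delta>) \<longrightarrow> \<bar>f x\<bar> \<le> L * \<delta>"
  using assms
proof (induction rule: span_induct_alt)
  case base
  show ?case by (intro exI[of _ 0]) (auto simp: linear_0)
next
  case (step c t y)
  then obtain L where L: "L \<ge> 0"
    "\<And>f \<delta>. linear f \<Longrightarrow> (\<forall>t\<in>T. \<bar>f t\<bar> \<le> \<delta>) \<Longrightarrow> \<bar>f y :: real\<bar> \<le> L * \<delta>" by blast
  show ?case
  proof (intro exI[of _ "\<bar>c\<bar> + L"] conjI allI impI)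
    fix f :: "'a \<Rightarrow> real" and \<delta>
    assume f: "linear f" "\<forall>t\<in>T. \<bar>f t\<bar> \<le> \<delta>"
    have "\<bar>f (c *\<^sub>R t + y)\<bar> \<le> \<bar>c\<bar> * \<bar>f t\<bar> + \<bar>f y\<bar>"
      by (simp add: linear_add[OF f(1)] linear_scale[OF f(1)] abs_mult[symmetric] abs_triangle_ineq)
    also have "\<dots> \<le> \<bar>c\<bar> * \<delta> + L * \<delta>"
      using f(2) step.hyps L(2)[OF f] by (intro add_mono mult_left_mono) auto
    finally show "\<bar>f (c *\<^sub>R t + y)\<bar> \<le> (\<bar>c\<bar> + L) * \<delta>" by (simp add: algebra_simps)
  qed (use L in auto)
qed

text \<open>
  For fixed \<open>v\<close> and \<open>\<beta>\<close>, the expression \<open>v \<bullet> (y - X \<beta>)\<close> is a linear functional of \<open>(y, X)\<close>. At the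
  point \<open>(axis i 1, 0)\<close> it takes the value \<open>v $ i\<close> whatever \<open>\<beta>\<close> is. That point is a difference of two
  observations with the same design, hence lies in the span of \<open>T\<close>.
\<close>

lemma direction_le_residuals:
  fixes T :: "('k::finite, 'q::finite) obs set"
  assumes "UNIV \<times> \<X> \<subseteq> affine hull T" "\<X> \<noteq> {}"
  shows "\<exists>L. \<forall>v \<beta>. \<forall>\<delta>\<ge>0. (\<forall>s\<in>T. \<bar>v \<bullet> (fst s - snd s *v \<beta>)\<bar> \<le> \<delta>) \<longrightarrow> norm v \<le> L * \<delta>"
proof -
  obtain X where X: "X \<in> \<X>" using assms(2) by blast
  have "(axis i 1, 0) \<in> span T" for i :: 'k
  proof -
    have "(axis i 1, X) \<in> span T" "(0, X) \<in> span T"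
      using X assms(1) affine_hull_subset_span[of T] by auto
    from span_diff[OF this] show ?thesis by simp
  qed
  then have "\<forall>i :: 'k. \<exists>L\<ge>0. \<forall>f :: ('k, 'q) obs \<Rightarrow> real. \<forall>\<delta>. linear f \<longrightarrow> (\<forall>t\<in>T. \<bar>f t\<bar> \<le> \<delta>) \<longrightarrow>
      \<bar>f (axis i 1, 0)\<bar> \<le> L * \<delta>"
    by (intro allI linear_functional_le_on_span)
  then obtain L where L: "\<And>i f \<delta>. linear f \<Longrightarrow> \<forall>t\<in>T. \<bar>f t\<bar> \<le> \<delta> \<Longrightarrow>
      \<bar>(f :: ('k, 'q) obs \<Rightarrow> real) (axis i 1, 0)\<bar> \<le> L i * \<delta>" by metis
  show ?thesis
  proof (intro exI[of _ "\<Sum>i\<in>UNIV. L i"] allI impI)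
    fix v :: "real ^ 'k" and \<beta> :: "real ^ 'q" and \<delta> :: real
    assume *: "\<forall>s\<in>T. \<bar>v \<bullet> (fst s - snd s *v \<beta>)\<bar> \<le> \<delta>"
    have lin: "linear (\<lambda>s :: ('k, 'q) obs. v \<bullet> (fst s - snd s *v \<beta>))"
      by (rule linearI) (simp_all add: matrix_vector_mult_add_rdistrib inner_add_right
          inner_diff_right scaleR_matrix_vector_assoc[symmetric] right_diff_distrib)
    have "\<bar>v $ i\<bar> \<le> L i * \<delta>" for i
      using L[OF lin *, of i] by (simp add: inner_axis)
    then have "(\<Sum>i\<in>UNIV. \<bar>v $ i\<bar>) \<le> (\<Sum>i\<in>UNIV. L i * \<delta>)" by (rule sum_mono)
    then show "norm v \<le> (\<Sum>i\<in>UNIV. L i) * \<delta>"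
      using norm_le_l1_cart[of v] by (simp add: sum_distrib_right)
  qed
qed

text \<open>
  The rows of the designs in \<open>T\<close> span the parameter space: a vector \<open>b\<close> orthogonal to all of them
  satisfies \<open>X b = 0\<close> on the affine hull of \<open>T\<close>, hence on all of the design space. The coordinates of
  \<open>b\<close> are therefore fixed linear combinations of entries of fitted values.
\<close>

lemma parameter_le_fitted_values:
  fixes T :: "('k::finite, 'q::finite) obs set"
  assumes hull: "UNIV \<times> \<X> \<subseteq> affine hull T"
    and ident: "\<And>b. (\<And>X. X \<in> \<X> \<Longrightarrow> X *v b = 0) \<Longrightarrow> b = 0"
  shows "\<exists>L. \<forall>b. \<forall>\<delta>\<ge>0. (\<forall>s\<in>T. norm (snd s *v b) \<le> \<delta>) \<longrightarrow> norm b \<le> L * \<delta>"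
proof -
  define R where "R = {snd s $ i | s i. s \<in> T}"
  have "span R = UNIV"
  proof (rule ccontr)
    assume "span R \<noteq> UNIV"
    then have dim: "dim R < DIM(real ^ 'q)" using dim_subset_UNIV[of R] by (simp add: dim_eq_full[symmetric])
    then obtain b where b: "b \<noteq> 0" "\<And>y. y \<in> span R \<Longrightarrow> orthogonal b y"
      using orthogonal_to_subspace_exists[OF dim] by metis
    have T: "snd s *v b = 0" if "s \<in> T" for s
    proof -
      have "snd s $ i \<bullet> b = 0" for i
      proof -
        have "snd s $ i \<in> R" using that unfolding R_def by blast
        from b(2)[OF span_base[OF this]] show ?thesis by (simp add: orthogonal_def inner_commute)
      qed
      then show ?thesis by (simp add: vec_eq_iff matrix_vector_mul_component)
    qed
    have "subspace {s :: ('k, 'q) obs. snd s *v b = 0}"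
      by (auto simp: subspace_def matrix_vector_mult_add_rdistrib scaleR_matrix_vector_assoc[symmetric])
    then have "affine hull T \<subseteq> {s. snd s *v b = 0}"
      using T by (intro hull_minimal subspace_imp_affine) auto
    then have "X *v b = 0" if "X \<in> \<X>" for X using hull that by force
    with ident b(1) show False by blast
  qed
  then have "axis q 1 \<in> span R" for q by simp
  then have "\<forall>q :: 'q. \<exists>L\<ge>0. \<forall>f :: real ^ 'q \<Rightarrow> real. \<forall>\<delta>. linear f \<longrightarrow> (\<forall>t\<in>R. \<bar>f t\<bar> \<le> \<delta>) \<longrightarrow>
      \<bar>f (axis q 1)\<bar> \<le> L * \<delta>"
    by (intro allI linear_functional_le_on_span)
  then obtain L where L: "\<And>q f \<delta>. linear f \<Longrightarrow> \<forall>t\<in>R. \<bar>f t\<bar> \<le> \<delta> \<Longrightarrow>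
      \<bar>(f :: real ^ 'q \<Rightarrow> real) (axis q 1)\<bar> \<le> L q * \<delta>" by metis
  show ?thesis
  proof (intro exI[of _ "\<Sum>q\<in>UNIV. L q"] allI impI)
    fix b :: "real ^ 'q" and \<delta> :: real
    assume *: "\<forall>s\<in>T. norm (snd s *v b) \<le> \<delta>"
    have R: "\<forall>t\<in>R. \<bar>b \<bullet> t\<bar> \<le> \<delta>"
    proof
      fix t assume "t \<in> R"
      then obtain s i where s: "s \<in> T" "t = snd s $ i" by (auto simp: R_def)
      then have "b \<bullet> t = (snd s *v b) $ i" by (simp add: matrix_vector_mul_component inner_commute)
      then show "\<bar>b \<bullet> t\<bar> \<le> \<delta>"
        using component_le_norm_cart[of "snd s *v b" i] * s(1) by fastforce
    qed
    have "linear (\<lambda>t. b \<bullet> t)" by (simp add: bounded_linear.linear bounded_linear_inner_right)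
    from L[OF this R] have "\<bar>b $ q\<bar> \<le> L q * \<delta>" for q by (simp add: inner_axis)
    then have "(\<Sum>q\<in>UNIV. \<bar>b $ q\<bar>) \<le> (\<Sum>q\<in>UNIV. L q * \<delta>)" by (rule sum_mono)
    then show "norm b \<le> (\<Sum>q\<in>UNIV. L q) * \<delta>"
      using norm_le_l1_cart[of b] by (simp add: sum_distrib_right)
  qed
qed

lemma uniform_constant:
  fixes P :: "'i \<Rightarrow> real \<Rightarrow> bool"
  assumes "finite I" "\<And>i. i \<in> I \<Longrightarrow> \<exists>L. P i L" "\<And>i L L'. P i L \<Longrightarrow> L \<le> L' \<Longrightarrow> P i L'"
  shows "\<exists>L>0. \<forall>i\<in>I. P i L"
proof -
  obtain L where L: "\<And>i. i \<in> I \<Longrightarrow> P i (L i)" using assms(2) by metis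
  have "P i (Max (insert 1 (L ` I)))" if "i \<in> I" for i
    using assms(1) that by (intro assms(3)[OF L]) auto
  moreover have "Max (insert 1 (L ` I)) > 0"
    using assms(1) by (intro less_le_trans[OF zero_less_one Max_ge]) auto
  ultimately show ?thesis by blast
qed

text \<open>
  There are finitely many sets \<open>J\<close> of indices, so a single constant serves all of them. It depends on
  the uncontaminated sample only.
\<close>

lemma sample_constants:
  fixes S :: "('k::finite, 'q::finite) obs list"
  assumes S: "set S \<subseteq> UNIV \<times> \<X>" and ne: "\<X> \<noteq> {}"
    and ident: "\<And>b. (\<And>X. X \<in> \<X> \<Longrightarrow> X *v b = 0) \<Longrightarrow> b = 0"
  obtains L where "L > 0"
    "\<And>J v \<beta> \<delta>. J \<subseteq> {..<length S} \<Longrightarrow> kappa \<X> S < card J \<Longrightarrow> 0 \<le> \<delta> \<Longrightarrow>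
       (\<And>j. j \<in> J \<Longrightarrow> \<bar>v \<bullet> (fst (S ! j) - snd (S ! j) *v \<beta>)\<bar> \<le> \<delta>) \<Longrightarrow> norm v \<le> L * \<delta>"
    "\<And>J b \<delta>. J \<subseteq> {..<length S} \<Longrightarrow> kappa \<X> S < card J \<Longrightarrow> 0 \<le> \<delta> \<Longrightarrow>
       (\<And>j. j \<in> J \<Longrightarrow> norm (snd (S ! j) *v b) \<le> \<delta>) \<Longrightarrow> norm b \<le> L * \<delta>"
proof -
  define \<J> where "\<J> = {J. J \<subseteq> {..<length S} \<and> kappa \<X> S < card J}"
  define A where "A J L \<longleftrightarrow> (\<forall>v \<beta>. \<forall>\<delta>\<ge>0.
    (\<forall>s\<in>(!) S ` J. \<bar>v \<bullet> (fst s - snd s *v \<beta>)\<bar> \<le> \<delta>) \<longrightarrow> norm v \<le> L * \<delta>)" for J L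
  define B where "B J L \<longleftrightarrow> (\<forall>b. \<forall>\<delta>\<ge>0.
    (\<forall>s\<in>(!) S ` J. norm (snd s *v b) \<le> \<delta>) \<longrightarrow> norm b \<le> L * \<delta>)" for J L
  have *: "x \<le> L * \<delta> \<Longrightarrow> L \<le> L' \<Longrightarrow> 0 \<le> \<delta> \<Longrightarrow> x \<le> L' * \<delta>" for x L L' \<delta> :: real
    using mult_right_mono[of L L' \<delta>] by linarith
  have mono: "A J L'" "B J M'" if "A J L" "L \<le> L'" "B J M" "M \<le> M'" for J L L' M M'
  proof -
    show "A J L'" unfolding A_def
    proof (intro allI impI)
      fix v \<beta> and \<delta> :: real
      assume "0 \<le> \<delta>" "\<forall>s\<in>(!) S ` J. \<bar>v \<bullet> (fst s - snd s *v \<beta>)\<bar> \<le> \<delta>"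
      with that(1) show "norm v \<le> L' * \<delta>" unfolding A_def by (intro *[OF _ that(2)]) simp_all
    qed
    show "B J M'" unfolding B_def
    proof (intro allI impI)
      fix b and \<delta> :: real
      assume "0 \<le> \<delta>" "\<forall>s\<in>(!) S ` J. norm (snd s *v b) \<le> \<delta>"
      with that(3) show "norm b \<le> M' * \<delta>" unfolding B_def by (intro *[OF _ that(4)]) simp_all
    qed
  qed
  have ex: "\<exists>L. A J L \<and> B J L" if "J \<in> \<J>" for J
  proof -
    have hull: "UNIV \<times> \<X> \<subseteq> affine hull ((!) S ` J)"
      using that by (intro affine_hull_of_many_points S) (auto simp: \<J>_def)
    obtain L1 where L1: "A J L1"
      using direction_le_residuals[OF hull ne] unfolding A_def by (rule exE)
    obtain L2 where L2: "B J L2"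
      using parameter_le_fitted_values[OF hull ident] unfolding B_def by (rule exE)
    from mono[OF L1 max.cobounded1 L2 max.cobounded2] show ?thesis by blast
  qed
  have fin: "finite \<J>" unfolding \<J>_def by (rule finite_subset[of _ "Pow {..<length S}"]) auto
  have step: "A J L' \<and> B J L'" if "A J L \<and> B J L" "L \<le> L'" for J L L'
    using that mono[of J L L' L L'] by simp
  have "\<exists>L>0. \<forall>J\<in>\<J>. A J L \<and> B J L"
  proof (rule uniform_constant[where P = "\<lambda>J L. A J L \<and> B J L"])
    show "finite \<J>" by (rule fin)
    show "\<exists>L. A J L \<and> B J L" if "J \<in> \<J>" for J using that by (rule ex)
    show "A J L' \<and> B J L'" if "A J L \<and> B J L" "L \<le> L'" for J L L' using that by (rule step)
  qed
  then obtain L where L: "L > 0" "\<And>J. J \<in> \<J> \<Longrightarrow> A J L" "\<And>J. J \<in> \<J> \<Longrightarrow> B J L" by blast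
  show thesis
  proof (rule that[of L])
    fix J v \<beta> and \<delta> :: real
    assume *: "J \<subseteq> {..<length S}" "kappa \<X> S < card J" "0 \<le> \<delta>"
      "\<And>j. j \<in> J \<Longrightarrow> \<bar>v \<bullet> (fst (S ! j) - snd (S ! j) *v \<beta>)\<bar> \<le> \<delta>"
    have "A J L" using * by (intro L(2)) (simp add: \<J>_def)
    then show "norm v \<le> L * \<delta>"
      using *(4) unfolding A_def by (elim allE[of _ v] allE[of _ \<beta>] allE[of _ \<delta>]) (simp add: *(3))
  next
    fix J b and \<delta> :: real
    assume *: "J \<subseteq> {..<length S}" "kappa \<X> S < card J" "0 \<le> \<delta>"
      "\<And>j. j \<in> J \<Longrightarrow> norm (snd (S ! j) *v b) \<le> \<delta>"
    have "B J L" using * by (intro L(3)) (simp add: \<J>_def)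
    then show "norm b \<le> L * \<delta>"
      using *(4) unfolding B_def by (elim allE[of _ b] allE[of _ \<delta>]) (simp add: *(3))
  qed (rule L)
qed

text \<open>
  The design lies in \<open>\<X>\<close> almost surely, so a parameter whose fitted values vanish on \<open>\<X>\<close> cannot be
  distinguished from \<open>0\<close>.
\<close>

lemma design_space_identifies:
  fixes P :: "('k::finite, 'q::finite) obs measure"
  assumes "prob_space P" "design_space P \<X>"
    and ident: "\<And>\<beta> \<beta>'. (AE s in P. snd s *v \<beta> = snd s *v \<beta>') \<Longrightarrow> \<beta> = \<beta>'"
    and zero: "\<And>X. X \<in> \<X> \<Longrightarrow> X *v b = 0"
  shows "b = 0"
proof (rule ident)
  interpret prob_space P by fact
  have 1: "measure P {s \<in> space P. snd s \<in> \<X>} = 1" using assms(2) by (simp add: design_space_def)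
  then have "{s \<in> space P. snd s \<in> \<X>} \<in> sets P" using measure_notin_sets[of "{s \<in> space P. snd s \<in> \<X>}" P] by force
  with 1 have "AE s in P. s \<in> {s \<in> space P. snd s \<in> \<X>}" using prob_eq_1 by blast
  then show "AE s in P. snd s *v b = snd s *v 0" by (rule AE_mp) (simp add: zero)
qed

section \<open>Bounded loss functions and M-scales\<close>

text \<open>
  Losses are applied to distances, so all conditions refer to the nonnegative half-line.
\<close>

locale bounded_loss =
  fixes \<rho> :: "real \<Rightarrow> real" and c :: real
  assumes zero: "\<rho> 0 = 0" and c_pos: "0 < c"
    and mono: "0 \<le> x \<Longrightarrow> x \<le> y \<Longrightarrow> \<rho> x \<le> \<rho> y"
    and saturated: "c \<le> x \<Longrightarrow> \<rho> x = \<rho> c"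
    and cont: "continuous_on {0..} \<rho>"
begin

lemma nonneg: "0 \<le> x \<Longrightarrow> 0 \<le> \<rho> x"
  using mono[of 0 x] zero by simp

lemma le_max: "0 \<le> x \<Longrightarrow> \<rho> x \<le> \<rho> c"
  using mono[of x c] saturated[of x] by (cases "x \<le> c") auto

lemma small_near_zero:
  assumes "0 < \<epsilon>"
  obtains \<eta> where "0 < \<eta>" "\<And>x. 0 \<le> x \<Longrightarrow> x \<le> \<eta> \<Longrightarrow> \<rho> x \<le> \<epsilon>"
proof -
  obtain d where d: "d > 0" "\<And>x. x \<in> {0..} \<Longrightarrow> dist x 0 < d \<Longrightarrow> dist (\<rho> x) (\<rho> 0) < \<epsilon>"
    using cont assms unfolding continuous_on_iff by (metis atLeast_iff order_refl)
  show thesis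
  proof (rule that[of "d / 2"])
    fix x :: real assume "0 \<le> x" "x \<le> d / 2"
    then show "\<rho> x \<le> \<epsilon>" using d(2)[of x] d(1) nonneg[of x] by (simp add: zero dist_real_def)
  qed (use d in simp)
qed

text \<open>
  The mean loss is continuous in the scale. For large scales it is near \<open>0\<close>. For small scales all
  positive distances are in the saturated range, and by assumption they are numerous enough for the
  mean loss to exceed \<open>b\<close>.
\<close>

lemma scale_exists:
  fixes d :: "nat \<Rightarrow> real"
  assumes n: "0 < n" and d: "\<And>i. 0 \<le> d i" and b: "0 < b"
    and many: "real n * b < real (card {i. i < n \<and> 0 < d i}) * \<rho> c"
  shows "\<exists>\<sigma>>0. (\<Sum>i<n. \<rho> (d i / \<sigma>)) / real n = b"
proof -
  define h where "h \<sigma> = (\<Sum>i<n. \<rho> (d i / \<sigma>)) / real n" for \<sigma>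
  obtain \<eta> where \<eta>: "0 < \<eta>" "\<And>x. 0 \<le> x \<Longrightarrow> x \<le> \<eta> \<Longrightarrow> \<rho> x \<le> b" using small_near_zero[OF b] by metis
  define K where "K = Max (insert 1 (d ` {..<n}))"
  have K: "d i \<le> K" if "i < n" for i using that by (simp add: K_def)
  have K0: "0 < K" unfolding K_def by (intro less_le_trans[OF zero_less_one Max_ge]) auto
  define D where "D = {i. i < n \<and> 0 < d i}"
  define m where "m = Min (insert 1 (d ` D))"
  have finD: "finite D" by (simp add: D_def)
  have m: "0 < m" "\<And>i. i \<in> D \<Longrightarrow> m \<le> d i"
    using finD by (auto simp: m_def D_def)
  define \<sigma>2 where "\<sigma>2 = K / \<eta>"
  define \<sigma>1 where "\<sigma>1 = min (m / c) \<sigma>2"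
  have pos: "0 < \<sigma>1" "\<sigma>1 \<le> \<sigma>2" using K0 \<eta>(1) m(1) c_pos by (auto simp: \<sigma>1_def \<sigma>2_def)
  have "(\<Sum>i<n. \<rho> (d i / \<sigma>2)) \<le> (\<Sum>i<n. b)"
  proof (rule sum_mono)
    fix i assume "i \<in> {..<n}"
    then have "d i / \<sigma>2 \<le> \<eta>" using K[of i] K0 \<eta>(1) by (simp add: \<sigma>2_def field_simps)
    then show "\<rho> (d i / \<sigma>2) \<le> b" using d[of i] pos by (intro \<eta>(2)) auto
  qed
  then have h2: "h \<sigma>2 \<le> b" using n by (simp add: h_def field_simps)
  have "real n * b \<le> (\<Sum>i\<in>D. \<rho> c)" using many by (simp add: D_def)
  also have "\<dots> = (\<Sum>i\<in>D. \<rho> (d i / \<sigma>1))"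
  proof (rule sum.cong)
    fix i assume "i \<in> D"
    have "c * \<sigma>1 \<le> m" using c_pos by (simp add: \<sigma>1_def min_def field_simps)
    then have "c \<le> d i / \<sigma>1" using m(2)[OF \<open>i \<in> D\<close>] pos by (simp add: field_simps)
    then show "\<rho> c = \<rho> (d i / \<sigma>1)" by (rule saturated[symmetric])
  qed simp
  also have "\<dots> \<le> (\<Sum>i<n. \<rho> (d i / \<sigma>1))"
    using d pos by (intro sum_mono2) (auto simp: D_def intro!: nonneg)
  finally have h1: "b \<le> h \<sigma>1" using n by (simp add: h_def field_simps)
  have "continuous_on {\<sigma>1..\<sigma>2} h"
    unfolding h_def using pos d n
    by (intro continuous_intros continuous_on_compose2[OF cont]) auto
  then obtain \<sigma> where "\<sigma>1 \<le> \<sigma>" "h \<sigma> = b" using IVT2'[OF h2 h1 pos(2)] by blast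
  with pos show ?thesis unfolding h_def by (intro exI[of _ \<sigma>]) auto
qed

text \<open>
  The points of \<open>I\<close> are arbitrarily bad, but each contributes at most \<open>\<rho> c\<close>. At a large scale the others
  contribute almost nothing, so the sum cannot reach \<open>n b\<close>.
\<close>

lemma scale_upper_bound:
  assumes n: "0 < n" and few: "real m * \<rho> c < real n * b"
  obtains \<sigma>max where "0 < \<sigma>max"
    "\<And>(d :: nat \<Rightarrow> real) I \<sigma>. I \<subseteq> {..<n} \<Longrightarrow> card I = m \<Longrightarrow> (\<And>i. 0 \<le> d i) \<Longrightarrow>
       (\<And>i. i < n \<Longrightarrow> i \<notin> I \<Longrightarrow> d i \<le> K) \<Longrightarrow> 0 < \<sigma> \<Longrightarrow> (\<Sum>i<n. \<rho> (d i / \<sigma>)) / real n = b \<Longrightarrow>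
       \<sigma> \<le> \<sigma>max"
proof -
  \<comment> \<open>half of the slack that the worst case of the points in \<open>I\<close> leaves, shared by \<open>n\<close> points\<close>
  define \<epsilon> where "\<epsilon> = (real n * b - real m * \<rho> c) / (2 * real n)"
  have eps: "0 < \<epsilon>" using assms by (simp add: \<epsilon>_def)
  obtain \<eta> where \<eta>: "0 < \<eta>" "\<And>x. 0 \<le> x \<Longrightarrow> x \<le> \<eta> \<Longrightarrow> \<rho> x \<le> \<epsilon>" using small_near_zero[OF eps] by metis
  show thesis
  proof (rule that[of "max 1 (K / \<eta>)"])
    fix d :: "nat \<Rightarrow> real" and I \<sigma>
    assume I: "I \<subseteq> {..<n}" "card I = m" and d: "\<And>i. 0 \<le> d i"
      and K: "\<And>i. i < n \<Longrightarrow> i \<notin> I \<Longrightarrow> d i \<le> K" and \<sigma>: "0 < \<sigma>"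
      and eq: "(\<Sum>i<n. \<rho> (d i / \<sigma>)) / real n = b"
    show "\<sigma> \<le> max 1 (K / \<eta>)"
    proof (rule ccontr)
      assume "\<not> \<sigma> \<le> max 1 (K / \<eta>)"
      then have "K / \<eta> \<le> \<sigma>" by simp
      then have K\<sigma>: "K \<le> \<eta> * \<sigma>" using \<eta>(1) by (simp add: field_simps)
      have "real n * b = (\<Sum>i<n. \<rho> (d i / \<sigma>))" using eq n by (simp add: field_simps)
      also have "\<dots> = (\<Sum>i\<in>I. \<rho> (d i / \<sigma>)) + (\<Sum>i\<in>{..<n} - I. \<rho> (d i / \<sigma>))"
        using sum.subset_diff[OF I(1), of "\<lambda>i. \<rho> (d i / \<sigma>)"] by simp
      also have "\<dots> \<le> (\<Sum>i\<in>I. \<rho> c) + (\<Sum>i\<in>{..<n} - I. \<epsilon>)"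
      proof (intro add_mono sum_mono)
        fix i assume "i \<in> {..<n} - I"
        then have "d i / \<sigma> \<le> \<eta>" using K[of i] K\<sigma> \<sigma> by (simp add: field_simps)
        then show "\<rho> (d i / \<sigma>) \<le> \<epsilon>" using d[of i] \<sigma> by (intro \<eta>(2)) auto
      qed (use d \<sigma> in \<open>auto intro!: le_max\<close>)
      also have "\<dots> \<le> real m * \<rho> c + real n * \<epsilon>"
      proof -
        have "real (card ({..<n} - I)) \<le> real n" using card_mono[of "{..<n}" "{..<n} - I"] by simp
        then show ?thesis using I eps by simp
      qed
      also have "\<dots> < real n * b" using few n by (simp add: \<epsilon>_def field_simps)
      finally show False by simp
    qed
  qed simp
qed

text \<open>
  At a smaller scale all distances that are at least \<open>\<delta>\<close> would be in the saturated range, and there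
  are too many of them.
\<close>

lemma scale_lower_bound:
  fixes d :: "nat \<Rightarrow> real"
  assumes n: "0 < n" and d: "\<And>i. 0 \<le> d i" and \<sigma>: "0 < \<sigma>"
    and eq: "(\<Sum>i<n. \<rho> (d i / \<sigma>)) / real n = b"
    and many: "real n * b < real (card {i. i < n \<and> \<delta> \<le> d i}) * \<rho> c"
  shows "\<delta> / c \<le> \<sigma>"
proof (rule ccontr)
  assume "\<not> \<delta> / c \<le> \<sigma>"
  then have \<delta>: "c * \<sigma> \<le> \<delta>" using c_pos by (simp add: field_simps)
  let ?D = "{i. i < n \<and> \<delta> \<le> d i}"
  have "real n * b < (\<Sum>i\<in>?D. \<rho> c)" using many by simp
  also have "\<dots> = (\<Sum>i\<in>?D. \<rho> (d i / \<sigma>))"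
  proof (rule sum.cong)
    fix i assume "i \<in> ?D"
    then have "c \<le> d i / \<sigma>" using \<delta> \<sigma> by (simp add: field_simps)
    then show "\<rho> c = \<rho> (d i / \<sigma>)" by (rule saturated[symmetric])
  qed simp
  also have "\<dots> \<le> (\<Sum>i<n. \<rho> (d i / \<sigma>))"
    using d \<sigma> by (intro sum_mono2) (auto intro!: nonneg)
  also have "\<dots> = real n * b" using eq n by (simp add: field_simps)
  finally show False by simp
qed

end

text \<open>
  Each index with \<open>e i \<ge> c\<^sub>1\<close> costs the full \<open>s\<^sub>1\<close>, while the total cost is at most the \<open>s\<^sub>1 / s\<^sub>0\<close>-fold
  of the cost of \<open>d\<close> under \<open>\<rho>\<^sub>0\<close>, which is \<open>n b\<close>.
\<close>

lemma many_small_distances: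
  fixes d e :: "nat \<Rightarrow> real"
  assumes d: "\<And>i. 0 \<le> d i" and e: "\<And>i. 0 \<le> e i"
    and \<rho>\<^sub>1: "\<And>x. 0 \<le> \<rho>\<^sub>1 x" "\<And>x. c\<^sub>1 \<le> x \<Longrightarrow> \<rho>\<^sub>1 x = s\<^sub>1" "0 < s\<^sub>1"
    and s\<^sub>0: "0 < s\<^sub>0" and cmp: "\<And>x. 0 \<le> x \<Longrightarrow> \<rho>\<^sub>1 x / s\<^sub>1 \<le> \<rho>\<^sub>0 x / s\<^sub>0"
    and le: "(\<Sum>i<n. \<rho>\<^sub>1 (e i)) \<le> (\<Sum>i<n. \<rho>\<^sub>1 (d i))"
    and eq: "(\<Sum>i<n. \<rho>\<^sub>0 (d i)) = real n * b"
  shows "real n - real n * (b / s\<^sub>0) \<le> real (card {i. i < n \<and> e i < c\<^sub>1})"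
proof -
  let ?G = "{i. i < n \<and> e i < c\<^sub>1}"
  have "(\<Sum>i\<in>{..<n} - ?G. \<rho>\<^sub>1 (e i)) = (\<Sum>i\<in>{..<n} - ?G. s\<^sub>1)"
    by (rule sum.cong) (auto intro!: \<rho>\<^sub>1(2))
  then have "(real n - real (card ?G)) * s\<^sub>1 = (\<Sum>i\<in>{..<n} - ?G. \<rho>\<^sub>1 (e i))"
  proof -
    have "card ?G \<le> card {..<n}" by (intro card_mono) auto
    moreover have "card ({..<n} - ?G) = card {..<n} - card ?G" by (intro card_Diff_subset) auto
    ultimately have "real (card ({..<n} - ?G)) = real n - real (card ?G)" by simp
    then show ?thesis using \<open>_ = (\<Sum>i\<in>{..<n} - ?G. s\<^sub>1)\<close> by simp
  qed
  also have "\<dots> \<le> (\<Sum>i<n. \<rho>\<^sub>1 (e i))" using \<rho>\<^sub>1(1) by (intro sum_mono2) auto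
  also have "\<dots> \<le> (\<Sum>i<n. \<rho>\<^sub>1 (d i))" by (rule le)
  also have "\<dots> \<le> (\<Sum>i<n. s\<^sub>1 / s\<^sub>0 * \<rho>\<^sub>0 (d i))"
    using cmp[OF d] \<rho>\<^sub>1(3) s\<^sub>0 by (intro sum_mono) (simp add: field_simps)
  also have "\<dots> = s\<^sub>1 / s\<^sub>0 * (\<Sum>i<n. \<rho>\<^sub>0 (d i))" by (rule sum_distrib_left[symmetric])
  also have "\<dots> = real n * (b / s\<^sub>0) * s\<^sub>1" by (simp add: eq)
  finally have "real n - real (card ?G) \<le> real n * (b / s\<^sub>0)"
    using \<rho>\<^sub>1(3) by (rule mult_right_le_imp_le)
  then show ?thesis by simp
qed

section \<open>Contaminated samples\<close>

definition residual :: "real ^ 'q \<Rightarrow> ('k::finite, 'q::finite) obs \<Rightarrow> real ^ 'k" where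
  "residual \<beta> s = fst s - snd s *v \<beta>"

lemma mahalanobis_power2:
  assumes "pds C"
  shows "(mahalanobis \<beta> C s)\<^sup>2 = residual \<beta> s \<bullet> (matrix_inv C *v residual \<beta> s)"
  unfolding mahalanobis_def residual_def
  by (rule real_sqrt_pow2) (rule pds_nonneg[OF pds_matrix_inv[OF assms]])

lemma mahalanobis_nonneg:
  assumes "pds C"
  shows "0 \<le> mahalanobis \<beta> C s"
  unfolding mahalanobis_def
  by (rule real_sqrt_ge_zero) (rule pds_nonneg[OF pds_matrix_inv[OF assms]])

lemma direction_le_mahalanobis:
  assumes "pds C"
  shows "\<bar>v \<bullet> residual \<beta> s\<bar> \<le> sqrt (v \<bullet> (C *v v)) * mahalanobis \<beta> C s"
proof (rule power2_le_imp_le)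
  show "\<bar>v \<bullet> residual \<beta> s\<bar>\<^sup>2 \<le> (sqrt (v \<bullet> (C *v v)) * mahalanobis \<beta> C s)\<^sup>2"
    using inner_le_pds_forms[OF assms, of v "residual \<beta> s"] pds_nonneg[OF assms, of v]
    by (simp add: power_mult_distrib mahalanobis_power2[OF assms])
qed (simp add: mahalanobis_nonneg[OF assms] pds_nonneg[OF assms])

lemma mahalanobis_le:
  assumes "pds C" "form_between a b C" "0 < a"
  shows "mahalanobis \<beta> C s \<le> norm (residual \<beta> s) / sqrt a"
proof (rule power2_le_imp_le)
  show "(mahalanobis \<beta> C s)\<^sup>2 \<le> (norm (residual \<beta> s) / sqrt a)\<^sup>2"
    using matrix_inv_form_le[OF assms, of "residual \<beta> s"] assms(3)
    by (simp add: mahalanobis_power2[OF assms(1)] power_divide dot_square_norm field_simps)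
qed (use assms(3) in simp)

text \<open>
  The comparison of Euclidean length and Mahalanobis distance is
  \<open>direction_le_mahalanobis\<close> in the direction of the residual itself.
\<close>

lemma norm_residual_le:
  assumes "pds C" "form_between a b C"
  shows "norm (residual \<beta> s) \<le> sqrt b * mahalanobis \<beta> C s"
proof (cases "residual \<beta> s = 0")
  case True
  have "0 \<le> axis undefined 1 \<bullet> (C *v axis undefined 1)" by (rule pds_nonneg[OF assms(1)])
  also have "\<dots> \<le> b"
    using assms(2)[unfolded form_between_def, rule_format, of "axis undefined 1"]
    by (simp add: inner_axis_axis)
  finally show ?thesis using True by (simp add: mahalanobis_nonneg[OF assms(1)])
next
  case False
  define u where "u = sgn (residual \<beta> s)"
  have u: "norm u = 1" using False by (simp add: u_def norm_sgn)
  have "norm (residual \<beta> s) = u \<bullet> residual \<beta> s"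
    using False by (simp add: u_def sgn_div_norm dot_square_norm power2_eq_square)
  also have "\<dots> \<le> sqrt (u \<bullet> (C *v u)) * mahalanobis \<beta> C s"
    using direction_le_mahalanobis[OF assms(1), of u \<beta> s] by linarith
  also have "\<dots> \<le> sqrt b * mahalanobis \<beta> C s"
  proof (intro mult_right_mono mahalanobis_nonneg assms)
    show "sqrt (u \<bullet> (C *v u)) \<le> sqrt b"
      using assms(2)[unfolded form_between_def, rule_format, of u] u by (simp add: dot_square_norm)
  qed
  finally show ?thesis .
qed

lemma corruptedD:
  assumes "S' \<in> corrupted \<X> S m"
  shows "\<exists>I. length S' = length S \<and> I \<subseteq> {..<length S} \<and> card I = m \<and>
    (\<forall>i. i < length S \<longrightarrow> i \<notin> I \<longrightarrow> S' ! i = S ! i) \<and> (\<forall>i\<in>I. S' ! i \<in> UNIV \<times> \<X>)"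
proof -
  obtain I where I: "length S' = length S" "I \<subseteq> {..<length S}" "card I = m"
    "\<forall>i<length S. if i \<in> I then S' ! i \<in> UNIV \<times> \<X> else S' ! i = S ! i"
    using assms unfolding corrupted_def by blast
  have "S' ! i = S ! i" if "i < length S" "i \<notin> I" for i
    using I(4)[rule_format, OF that(1)] that(2) by simp
  moreover have "S' ! i \<in> UNIV \<times> \<X>" if "i \<in> I" for i
    using I(4)[rule_format, of i] I(2) that by (simp add: subset_eq)
  ultimately show ?thesis using I(1-3) by (intro exI[of _ I]) simp
qed

lemma corrupted_in_samples:
  assumes "S \<in> samples n \<X>" "S' \<in> corrupted \<X> S m"
  shows "S' \<in> samples n \<X>"
proof -
  obtain I where I: "length S' = length S" "I \<subseteq> {..<length S}" "card I = m"
      "\<forall>i. i < length S \<longrightarrow> i \<notin> I \<longrightarrow> S' ! i = S ! i" "\<forall>i\<in>I. S' ! i \<in> UNIV \<times> \<X>"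
      using corruptedD[OF assms(2)] by blast
  have S: "length S = n" "set S \<subseteq> UNIV \<times> \<X>" using assms(1) by (auto simp: samples_def)
  have "S' ! i \<in> UNIV \<times> \<X>" if "i < length S" for i
  proof (cases "i \<in> I")
    case False
    then have "S' ! i = S ! i" using I(4) that by simp
    then show ?thesis using S(2) nth_mem[OF that] by (simp add: subset_eq)
  qed (rule I(5)[rule_format])
  then have "set S' \<subseteq> UNIV \<times> \<X>" unfolding set_conv_nth I(1) by blast
  then show ?thesis using I(1) S(1) by (simp add: samples_def)
qed

text \<open>
  The sample \<open>S\<close> is the uncontaminated one, \<open>m\<close> of whose points are replaced, and \<open>L\<close> is the constant
  of \<open>sample_constants\<close>. The quotient \<open>b / \<rho> c\<close> is \<open>r\<^sub>0\<close>. The two inequalities on \<open>m\<close> say that the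
  contamination can neither push the scale to infinity nor force it to zero.
\<close>

locale contaminated_sample = bounded_loss \<rho> c for \<rho> c +
  fixes \<X> :: "(real ^ 'q::finite ^ 'k::finite) set" and S :: "('k, 'q) obs list"
    and m :: nat and b L :: real
  assumes L_pos: "0 < L"
    and direction_bound: "\<And>J v \<beta> \<delta>. J \<subseteq> {..<length S} \<Longrightarrow> kappa \<X> S < card J \<Longrightarrow> 0 \<le> \<delta> \<Longrightarrow>
       (\<And>j. j \<in> J \<Longrightarrow> \<bar>v \<bullet> residual \<beta> (S ! j)\<bar> \<le> \<delta>) \<Longrightarrow> norm v \<le> L * \<delta>"
    and parameter_bound: "\<And>J (\<beta> :: real ^ 'q) \<delta>. J \<subseteq> {..<length S} \<Longrightarrow> kappa \<X> S < card J \<Longrightarrow> 0 \<le> \<delta> \<Longrightarrow>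
       (\<And>j. j \<in> J \<Longrightarrow> norm (snd (S ! j) *v \<beta>) \<le> \<delta>) \<Longrightarrow> norm \<beta> \<le> L * \<delta>"
    and b_pos: "0 < b" and max_pos: "0 < \<rho> c"
    and few: "real m < real (length S) * (b / \<rho> c)"
    and many: "real m + real (kappa \<X> S) < real (length S) - real (length S) * (b / \<rho> c)"
begin

lemma length_pos: "0 < length S"
  using few by (cases "length S") auto

text \<open>
  More than \<open>\<kappa>\<close> points cannot all lie in a strip of half-width \<open>1 / (2 L)\<close>: by the choice of \<open>L\<close> its
  direction would have length at most \<open>1 / 2\<close>. Any constant below \<open>1 / L\<close> would do as half-width.
\<close>

lemma far_point:
  assumes "J \<subseteq> {..<length S}" "kappa \<X> S < card J" "norm v = 1"
  shows "\<exists>j\<in>J. 1 / (2 * L) < \<bar>v \<bullet> residual \<beta> (S ! j)\<bar>"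
proof (rule ccontr)
  assume "\<not> ?thesis"
  then have "norm v \<le> L * (1 / (2 * L))"
    using L_pos by (intro direction_bound[OF assms(1,2), where \<beta> = \<beta>]) (auto simp: not_less)
  with assms(3) L_pos show False by simp
qed

text \<open>
  At most \<open>\<kappa>\<close> original and \<open>m\<close> replaced points lie in the strip.
\<close>

lemma many_far_points:
  assumes S': "S' \<in> corrupted \<X> S m" and v: "norm v = 1"
  shows "real (length S) * b < real (card {i. i < length S \<and> 1 / (2 * L) < \<bar>v \<bullet> residual \<beta> (S' ! i)\<bar>}) * \<rho> c"
proof -
  obtain I where I: "length S' = length S" "I \<subseteq> {..<length S}" "card I = m"
      "\<forall>i. i < length S \<longrightarrow> i \<notin> I \<longrightarrow> S' ! i = S ! i" "\<forall>i\<in>I. S' ! i \<in> UNIV \<times> \<X>"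
      using corruptedD[OF S'] by blast
  define F where "F = {i. i < length S \<and> 1 / (2 * L) < \<bar>v \<bullet> residual \<beta> (S' ! i)\<bar>}"
  define N where "N = {..<length S} - F - I"
  have "card N \<le> kappa \<X> S"
  proof (rule ccontr)
    assume *: "\<not> card N \<le> kappa \<X> S"
    have N: "N \<subseteq> {..<length S}" by (auto simp: N_def)
    have "\<exists>j\<in>N. 1 / (2 * L) < \<bar>v \<bullet> residual \<beta> (S ! j)\<bar>"
      using * by (intro far_point N v) simp
    then obtain j where "j \<in> N" "1 / (2 * L) < \<bar>v \<bullet> residual \<beta> (S ! j)\<bar>" by blast
    then show False using I(4)[rule_format, of j] by (auto simp: N_def F_def)
  qed
  moreover have "length S \<le> card (F \<union> I \<union> N)"
    using card_mono[of "F \<union> I \<union> N" "{..<length S}"] finite_subset[OF I(2)]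
    by (auto simp: N_def F_def)
  moreover have "card (F \<union> I \<union> N) \<le> card F + m + card N"
    using card_Un_le[of "F \<union> I" N] card_Un_le[of F I] I(3) by linarith
  ultimately have "real (length S) \<le> real (card F) + real m + real (kappa \<X> S)" by linarith
  with many have "real (length S) * (b / \<rho> c) < real (card F)" by linarith
  then have "real (length S) * (b / \<rho> c) * \<rho> c < real (card F) * \<rho> c"
    using max_pos by (rule mult_strict_right_mono)
  then show ?thesis using max_pos by (simp add: F_def)
qed

lemma scale_solutions_nonempty:
  assumes S': "S' \<in> corrupted \<X> S m" and C: "pds C"
  shows "scale_solutions \<rho> b \<beta> C S' \<noteq> {}"
proof -
  have len: "length S' = length S" using S' by (simp add: corrupted_def)
  define v :: "real ^ 'k" where "v = axis undefined 1"
  define d where "d i = mahalanobis \<beta> C (S' ! i)" for i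
  let ?F = "{i. i < length S \<and> 1 / (2 * L) < \<bar>v \<bullet> residual \<beta> (S' ! i)\<bar>}"
  have v: "norm v = 1" by (simp add: v_def norm_axis_1)
  have "?F \<subseteq> {i. i < length S \<and> 0 < d i}"
  proof (intro subsetI CollectI conjI)
    fix i assume i: "i \<in> ?F"
    then have "0 < \<bar>v \<bullet> residual \<beta> (S' ! i)\<bar>" using L_pos by (auto intro: less_trans[of 0 "1 / (2 * L)"])
    with direction_le_mahalanobis[OF C, of v \<beta> "S' ! i"] have "d i \<noteq> 0" by (auto simp: d_def)
    with mahalanobis_nonneg[OF C, of \<beta> "S' ! i"] show "0 < d i" by (simp add: d_def)
  qed simp
  then have "card ?F \<le> card {i. i < length S \<and> 0 < d i}" by (intro card_mono) auto
  then have "real (card ?F) * \<rho> c \<le> real (card {i. i < length S \<and> 0 < d i}) * \<rho> c"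
    using max_pos by (intro mult_right_mono) auto
  with many_far_points[OF S' v, of \<beta>]
  have "real (length S) * b < real (card {i. i < length S \<and> 0 < d i}) * \<rho> c" by linarith
  then have "\<exists>\<sigma>>0. (\<Sum>i<length S. \<rho> (d i / \<sigma>)) / real (length S) = b"
    using mahalanobis_nonneg[OF C] by (intro scale_exists length_pos b_pos) (simp_all only: d_def)
  then show ?thesis by (auto simp: scale_solutions_def mean_loss_def d_def len)
qed

text \<open>
  The lower bound uses the points outside one strip, whose Mahalanobis distances are bounded below
  because the form of \<open>C\<close> is bounded above. The upper bound uses the original points that are left,
  whose Mahalanobis distances are bounded above because the form of \<open>C\<close> is bounded below.
\<close>

lemma scale_bounds:
  assumes a0: "0 < a\<^sub>0" and B: "0 \<le> B"
  obtains \<sigma>lo \<sigma>hi where "0 < \<sigma>lo" "0 < \<sigma>hi"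
    "\<And>S' \<beta> C \<sigma>. S' \<in> corrupted \<X> S m \<Longrightarrow> pds C \<Longrightarrow> form_between a\<^sub>0 A\<^sub>0 C \<Longrightarrow> norm \<beta> \<le> B \<Longrightarrow>
       \<sigma> \<in> scale_solutions \<rho> b \<beta> C S' \<Longrightarrow> \<sigma>lo \<le> \<sigma> \<and> \<sigma> \<le> \<sigma>hi"
proof -
  define K where "K = (\<Sum>i<length S. norm (fst (S ! i)) + onorm ((*v) (snd (S ! i))) * B)"
  have res: "norm (residual \<beta> (S ! i)) \<le> K" if "i < length S" "norm \<beta> \<le> B" for i \<beta>
  proof -
    have nn: "0 \<le> onorm ((*v) (snd (S ! i)))" for i
      by (rule onorm_pos_le) (rule matrix_vector_mul_bounded_linear)
    have "norm (residual \<beta> (S ! i)) \<le> norm (fst (S ! i)) + norm (snd (S ! i) *v \<beta>)"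
      unfolding residual_def by (rule norm_triangle_ineq4)
    also have "norm (snd (S ! i) *v \<beta>) \<le> onorm ((*v) (snd (S ! i))) * norm \<beta>"
      by (rule onorm) (rule matrix_vector_mul_bounded_linear)
    also have "\<dots> \<le> onorm ((*v) (snd (S ! i))) * B" using that(2) nn by (rule mult_left_mono)
    also have "norm (fst (S ! i)) + onorm ((*v) (snd (S ! i))) * B \<le> K"
      unfolding K_def using that(1) nn B by (intro member_le_sum) auto
    finally show ?thesis by simp
  qed
  have "real m * \<rho> c < real (length S) * b"
    using mult_strict_right_mono[OF few max_pos] max_pos by simp
  from scale_upper_bound[OF length_pos this, of "K / sqrt a\<^sub>0"] obtain \<sigma>hi where hi: "0 < \<sigma>hi"
    "\<And>(d :: nat \<Rightarrow> real) I \<sigma>. I \<subseteq> {..<length S} \<Longrightarrow> card I = m \<Longrightarrow> (\<And>i. 0 \<le> d i) \<Longrightarrow>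
       (\<And>i. i < length S \<Longrightarrow> i \<notin> I \<Longrightarrow> d i \<le> K / sqrt a\<^sub>0) \<Longrightarrow> 0 < \<sigma> \<Longrightarrow>
       (\<Sum>i<length S. \<rho> (d i / \<sigma>)) / real (length S) = b \<Longrightarrow> \<sigma> \<le> \<sigma>hi" by metis
  \<comment> \<open>the maximum makes the bound positive, so that it can be divided by\<close>
  define A where "A = max 1 A\<^sub>0"
  define \<delta> where "\<delta> = 1 / (2 * L) / sqrt A"
  have A: "0 < A" "A\<^sub>0 \<le> A" by (simp_all add: A_def)
  show thesis
  proof (rule that)
    show "0 < \<delta> / c" using L_pos c_pos A by (simp add: \<delta>_def)
    show "0 < \<sigma>hi" by (rule hi)
    fix S' \<beta> C \<sigma>
    assume S': "S' \<in> corrupted \<X> S m" and C: "pds C" "form_between a\<^sub>0 A\<^sub>0 C" and \<beta>: "norm \<beta> \<le> B"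
      and \<sigma>: "\<sigma> \<in> scale_solutions \<rho> b \<beta> C S'"
    obtain I where I: "length S' = length S" "I \<subseteq> {..<length S}" "card I = m"
      "\<forall>i. i < length S \<longrightarrow> i \<notin> I \<longrightarrow> S' ! i = S ! i" "\<forall>i\<in>I. S' ! i \<in> UNIV \<times> \<X>"
      using corruptedD[OF S'] by blast
    define d where "d i = mahalanobis \<beta> C (S' ! i)" for i
    have d: "0 \<le> d i" for i by (simp add: d_def mahalanobis_nonneg[OF C(1)])
    have \<sigma>: "0 < \<sigma>" "(\<Sum>i<length S. \<rho> (d i / \<sigma>)) / real (length S) = b"
      using \<sigma> by (simp_all add: scale_solutions_def mean_loss_def d_def I(1))
    have "d i \<le> K / sqrt a\<^sub>0" if "i < length S" "i \<notin> I" for i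
    proof -
      have "d i \<le> norm (residual \<beta> (S ! i)) / sqrt a\<^sub>0"
        using mahalanobis_le[OF C a0, of \<beta> "S ! i"] I(4)[rule_format, OF that] by (simp add: d_def)
      also have "\<dots> \<le> K / sqrt a\<^sub>0" using res[OF that(1) \<beta>] a0 by (intro divide_right_mono) auto
      finally show ?thesis .
    qed
    then have upper: "\<sigma> \<le> \<sigma>hi" by (intro hi(2)[of I d] I d \<sigma>)
    \<comment> \<open>any unit vector is good enough\<close>
    define v :: "real ^ 'k" where "v = axis undefined 1"
    have v: "norm v = 1" by (simp add: v_def norm_axis_1)
    let ?F = "{i. i < length S \<and> 1 / (2 * L) < \<bar>v \<bullet> residual \<beta> (S' ! i)\<bar>}"
    have "?F \<subseteq> {i. i < length S \<and> \<delta> \<le> d i}"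
    proof (intro subsetI CollectI conjI)
      fix i assume i: "i \<in> ?F"
      have "sqrt (v \<bullet> (C *v v)) \<le> sqrt A"
        using C(2)[unfolded form_between_def, rule_format, of v] v A(2) by (simp add: dot_square_norm)
      then have "sqrt (v \<bullet> (C *v v)) * d i \<le> sqrt A * d i" by (rule mult_right_mono) (rule d)
      with direction_le_mahalanobis[OF C(1), of v \<beta> "S' ! i"] i
      have "1 / (2 * L) \<le> sqrt A * d i" by (simp add: d_def)
      moreover have "0 < sqrt A" using A(1) by simp
      ultimately have "1 / (2 * L) / sqrt A \<le> d i"
        using pos_divide_le_eq[of "sqrt A" "1 / (2 * L)" "d i"] by (simp only: mult.commute)
      then show "\<delta> \<le> d i" by (simp only: \<delta>_def)
    qed simp
    then have "card ?F \<le> card {i. i < length S \<and> \<delta> \<le> d i}" by (intro card_mono) auto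
    then have "real (card ?F) * \<rho> c \<le> real (card {i. i < length S \<and> \<delta> \<le> d i}) * \<rho> c"
      using max_pos by (intro mult_right_mono) auto
    with many_far_points[OF S' v, of \<beta>]
    have "real (length S) * b < real (card {i. i < length S \<and> \<delta> \<le> d i}) * \<rho> c" by linarith
    then have "\<delta> / c \<le> \<sigma>" by (rule scale_lower_bound[OF length_pos d \<sigma>])
    with upper show "\<delta> / c \<le> \<sigma> \<and> \<sigma> \<le> \<sigma>hi" by simp
  qed
qed

text \<open>
  An estimate \<open>(\<beta>, C)\<close> that improves on the initial one fits more than \<open>\<kappa>\<close> original points \<open>J\<close> within
  Mahalanobis distance \<open>M\<close>. In each direction \<open>v\<close> some point of \<open>J\<close> is at distance at least \<open>1 / (2 L)\<close>
  from the fit, so the form of \<open>C\<close> at \<open>v\<close> is at least \<open>(1 / (2 L M))\<^sup>2\<close>. The upper bound on the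
  form follows from \<open>det C = 1\<close>. It makes the residuals on \<open>J\<close> bounded in norm, which bounds \<open>\<beta>\<close>.
\<close>

lemma second_stage_bounds:
  assumes hi: "0 < \<sigma>hi" and c1: "0 < c\<^sub>1"
    and \<rho>\<^sub>1: "\<And>x. 0 \<le> \<rho>\<^sub>1 x" "\<And>x. c\<^sub>1 \<le> x \<Longrightarrow> \<rho>\<^sub>1 x = s\<^sub>1" "0 < s\<^sub>1"
    and cmp: "\<And>x. 0 \<le> x \<Longrightarrow> \<rho>\<^sub>1 x / s\<^sub>1 \<le> \<rho> x / \<rho> c"
  obtains a A K where "0 < a"
    "\<And>S' \<beta>\<^sub>0 C\<^sub>0 \<sigma> \<beta> C. S' \<in> corrupted \<X> S m \<Longrightarrow> pds C\<^sub>0 \<Longrightarrow> \<sigma> \<in> scale_solutions \<rho> b \<beta>\<^sub>0 C\<^sub>0 S' \<Longrightarrow>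
       \<sigma> \<le> \<sigma>hi \<Longrightarrow> pds C \<Longrightarrow> det C = 1 \<Longrightarrow>
       mean_loss \<rho>\<^sub>1 \<sigma> S' \<beta> C \<le> mean_loss \<rho>\<^sub>1 \<sigma> S' \<beta>\<^sub>0 C\<^sub>0 \<Longrightarrow> form_between a A C \<and> norm \<beta> \<le> K"
proof -
  define M where "M = c\<^sub>1 * \<sigma>hi"
  define a where "a = (1 / (2 * L) / M)\<^sup>2"
  define A where "A = real CARD('k) * (fact CARD('k) * (max (inverse a) 1) ^ CARD('k))"
  define Y where "Y = (\<Sum>i<length S. norm (fst (S ! i)))"
  have M: "0 < M" using hi c1 by (simp add: M_def)
  have a: "0 < a" using L_pos M by (simp add: a_def)
  have A: "0 \<le> A" by (simp add: A_def)
  have Y: "0 \<le> Y" unfolding Y_def by (intro sum_nonneg) auto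
  show thesis
  proof (rule that[of a])
    fix S' \<beta>\<^sub>0 C\<^sub>0 \<sigma> \<beta> C
    assume S': "S' \<in> corrupted \<X> S m" and C0: "pds C\<^sub>0" and \<sigma>: "\<sigma> \<in> scale_solutions \<rho> b \<beta>\<^sub>0 C\<^sub>0 S'"
      and \<sigma>hi: "\<sigma> \<le> \<sigma>hi" and C: "pds C" "det C = 1"
      and le: "mean_loss \<rho>\<^sub>1 \<sigma> S' \<beta> C \<le> mean_loss \<rho>\<^sub>1 \<sigma> S' \<beta>\<^sub>0 C\<^sub>0"
    obtain I where I: "length S' = length S" "I \<subseteq> {..<length S}" "card I = m"
      "\<forall>i. i < length S \<longrightarrow> i \<notin> I \<longrightarrow> S' ! i = S ! i" "\<forall>i\<in>I. S' ! i \<in> UNIV \<times> \<X>"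
      using corruptedD[OF S'] by blast
    have \<sigma>0: "0 < \<sigma>" using \<sigma> by (simp add: scale_solutions_def)
    define e where "e i = mahalanobis \<beta> C (S' ! i) / \<sigma>" for i
    define d where "d i = mahalanobis \<beta>\<^sub>0 C\<^sub>0 (S' ! i) / \<sigma>" for i
    define G where "G = {i. i < length S \<and> e i < c\<^sub>1}"
    have "real (length S) - real (length S) * (b / \<rho> c) \<le> real (card G)"
      unfolding G_def
    proof (rule many_small_distances[OF _ _ \<rho>\<^sub>1 max_pos cmp])
      show "0 \<le> d i" "0 \<le> e i" for i
        unfolding d_def e_def
        using \<sigma>0 by (intro divide_nonneg_pos mahalanobis_nonneg C(1) C0; simp)+
      show "(\<Sum>i<length S. \<rho>\<^sub>1 (e i)) \<le> (\<Sum>i<length S. \<rho>\<^sub>1 (d i))"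
        using le length_pos by (simp add: mean_loss_def d_def e_def I(1) divide_le_cancel)
      show "(\<Sum>i<length S. \<rho> (d i)) = real (length S) * b"
        using \<sigma> length_pos by (simp add: scale_solutions_def mean_loss_def d_def I(1) field_simps)
    qed
    define J where "J = G - I"
    have J: "J \<subseteq> {..<length S}" by (auto simp: J_def G_def)
    have "card G \<le> card J + m"
      using card_mono[of "J \<union> I" G] card_Un_le[of J I] I(3) finite_subset[OF I(2)] finite_subset[OF J]
      by (auto simp: J_def)
    with many \<open>_ \<le> real (card G)\<close> have J\<kappa>: "kappa \<X> S < card J" by linarith
    have small: "mahalanobis \<beta> C (S ! j) \<le> M" if "j \<in> J" for j
    proof -
      have "S' ! j = S ! j" using that J by (intro I(4)[rule_format]) (auto simp: J_def)
      then have "mahalanobis \<beta> C (S ! j) < c\<^sub>1 * \<sigma>"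
        using that \<sigma>0 by (simp add: J_def G_def e_def field_simps)
      also have "\<dots> \<le> M" unfolding M_def using \<sigma>hi c1 by simp
      finally show ?thesis by simp
    qed
    have lower: "a \<le> v \<bullet> (C *v v)" if v: "norm v = 1" for v
    proof -
      obtain j where j: "j \<in> J" "1 / (2 * L) < \<bar>v \<bullet> residual \<beta> (S ! j)\<bar>"
        using far_point[OF J J\<kappa> v] by blast
      have "1 / (2 * L) \<le> sqrt (v \<bullet> (C *v v)) * mahalanobis \<beta> C (S ! j)"
        using j(2) direction_le_mahalanobis[OF C(1), of v \<beta> "S ! j"] by linarith
      also have "\<dots> \<le> sqrt (v \<bullet> (C *v v)) * M"
        using small[OF j(1)] pds_nonneg[OF C(1)] by (intro mult_left_mono) auto
      finally have "1 / (2 * L) / M \<le> sqrt (v \<bullet> (C *v v))" using M by (simp only: pos_divide_le_eq)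
      then have "a \<le> (sqrt (v \<bullet> (C *v v)))\<^sup>2"
        unfolding a_def using L_pos M by (intro power_mono) auto
      then show ?thesis using pds_nonneg[OF C(1)] by simp
    qed
    have form: "form_between a A C"
      unfolding A_def by (rule form_upper_bound_of_det_one[OF C a lower])
    have "norm (snd (S ! j) *v \<beta>) \<le> Y + sqrt A * M" if "j \<in> J" for j
    proof -
      have "norm (snd (S ! j) *v \<beta>) \<le> norm (fst (S ! j)) + norm (residual \<beta> (S ! j))"
        using norm_triangle_ineq4[of "fst (S ! j)" "residual \<beta> (S ! j)"] by (simp add: residual_def)
      moreover have "norm (fst (S ! j)) \<le> Y"
        unfolding Y_def using that J by (intro member_le_sum) auto
      moreover have "norm (residual \<beta> (S ! j)) \<le> sqrt A * mahalanobis \<beta> C (S ! j)"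
        by (rule norm_residual_le[OF C(1) form])
      moreover have "sqrt A * mahalanobis \<beta> C (S ! j) \<le> sqrt A * M"
        using small[OF that] A by (intro mult_left_mono) auto
      ultimately show ?thesis by linarith
    qed
    then have "norm \<beta> \<le> L * (Y + sqrt A * M)"
      using A Y M by (intro parameter_bound[OF J J\<kappa>]) auto
    with form show "form_between a A C \<and> norm \<beta> \<le> L * (Y + sqrt A * M)" by simp
  qed (rule a)
qed

end

section \<open>Breakdown points\<close>

lemma SUP_ereal_neq_infinity_iff:
  fixes f :: "'a \<Rightarrow> real"
  shows "(SUP x\<in>A. ereal (f x)) \<noteq> \<infinity> \<longleftrightarrow> (\<exists>B. \<forall>x\<in>A. f x \<le> B)"
proof
  assume "(SUP x\<in>A. ereal (f x)) \<noteq> \<infinity>"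
  then obtain B where B: "(SUP x\<in>A. ereal (f x)) < ereal (real B)"
    using less_PInf_Ex_of_nat by auto
  have "f x \<le> real B" if "x \<in> A" for x
    using le_less_trans[OF SUP_upper[OF that] B] by simp
  then show "\<exists>B. \<forall>x\<in>A. f x \<le> B" by blast
next
  assume "\<exists>B. \<forall>x\<in>A. f x \<le> B"
  then obtain B where "\<forall>x\<in>A. f x \<le> B" by blast
  then have "(SUP x\<in>A. ereal (f x)) \<le> ereal B" by (intro SUP_least) simp
  then show "(SUP x\<in>A. ereal (f x)) \<noteq> \<infinity>" by auto
qed

lemma not_reg_breaks_iff:
  "\<not> reg_breaks \<X> \<beta> S m \<longleftrightarrow> (\<exists>B\<ge>0. \<forall>S'\<in>corrupted \<X> S m. norm (\<beta> S') \<le> B)"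
  unfolding reg_breaks_def SUP_ereal_neq_infinity_iff
proof safe
  fix B assume B: "\<forall>x\<in>corrupted \<X> S m. norm (\<beta> S - \<beta> x) \<le> B"
  have "norm (\<beta> S') \<le> norm (\<beta> S) + \<bar>B\<bar>" if "S' \<in> corrupted \<X> S m" for S'
    using B[rule_format, OF that] norm_triangle_ineq2[of "\<beta> S'" "\<beta> S"]
    by (simp add: norm_minus_commute)
  then show "\<exists>B\<ge>0. \<forall>S'\<in>corrupted \<X> S m. norm (\<beta> S') \<le> B"
    by (intro exI[of _ "norm (\<beta> S) + \<bar>B\<bar>"]) auto
next
  fix B assume B: "\<forall>S'\<in>corrupted \<X> S m. norm (\<beta> S') \<le> B"
  have "norm (\<beta> S - \<beta> S') \<le> norm (\<beta> S) + B" if "S' \<in> corrupted \<X> S m" for S'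
    using B[rule_format, OF that] norm_triangle_ineq4[of "\<beta> S" "\<beta> S'"] by simp
  then show "\<exists>B. \<forall>x\<in>corrupted \<X> S m. norm (\<beta> S - \<beta> x) \<le> B" by blast
qed

text \<open>
  Breakdown of a covariance estimator is explosion or implosion of the quadratic form; this lemma and
  its converse \<open>not_cov_breaks_of_form_between\<close> remove eigenvalues from the argument.
\<close>

lemma form_between_of_not_cov_breaks:
  assumes "\<not> cov_breaks \<X> V \<theta> S m" "pds (V (\<theta> S))" "\<And>S'. S' \<in> corrupted \<X> S m \<Longrightarrow> pds (V (\<theta> S'))"
  obtains a A where "0 < a" "\<And>S'. S' \<in> corrupted \<X> S m \<Longrightarrow> form_between a A (V (\<theta> S'))"
proof -
  obtain B where B: "\<And>S'. S' \<in> corrupted \<X> S m \<Longrightarrow> pds_dist (V (\<theta> S)) (V (\<theta> S')) \<le> B"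
    using assms(1) unfolding cov_breaks_def SUP_ereal_neq_infinity_iff by blast
  show thesis
  proof (rule that)
    show "0 < inverse (inverse (smallest_eigenval (V (\<theta> S))) + \<bar>B\<bar>)"
      using pds_smallest_eigenval_pos[OF assms(2)] by (simp add: add_pos_nonneg)
    fix S' assume S': "S' \<in> corrupted \<X> S m"
    show "form_between (inverse (inverse (smallest_eigenval (V (\<theta> S))) + \<bar>B\<bar>))
        (largest_eigenval (V (\<theta> S)) + \<bar>B\<bar>) (V (\<theta> S'))"
      using B[OF S'] by (intro form_between_of_pds_dist assms(2) assms(3)[OF S']) linarith
  qed
qed

lemma not_cov_breaks_of_form_between:
  assumes "0 < a" "\<And>S'. S' \<in> corrupted \<X> S m \<Longrightarrow> pds (V (\<theta> S'))"
    "\<And>S'. S' \<in> corrupted \<X> S m \<Longrightarrow> form_between a A (V (\<theta> S'))"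
  shows "\<not> cov_breaks \<X> V \<theta> S m"
  unfolding cov_breaks_def SUP_ereal_neq_infinity_iff
  using pds_dist_of_form_between[OF assms(2,3,1)] by blast

lemma breakdown_point_le:
  "1 \<le> m \<Longrightarrow> m \<le> n \<Longrightarrow> breaks m \<Longrightarrow> breakdown_point n breaks \<le> ereal (real m / real n)"
  unfolding breakdown_point_def by (rule Inf_lower) blast

lemma SUP_saturated:
  fixes \<rho> :: "real \<Rightarrow> real"
  assumes "c \<in> A" "\<And>x. x \<in> A \<Longrightarrow> \<rho> x \<le> \<rho> c"
  shows "(SUP x\<in>A. \<rho> x) = \<rho> c"
  using assms by (intro cSup_eq_maximum) auto

lemma bounded_lossI:
  assumes "\<rho> 0 = 0" "0 < c" "\<And>x. c \<le> x \<Longrightarrow> \<rho> x = \<rho> c"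
    "continuous_on {0..c} \<rho>" "strict_mono_on {0..c} \<rho>"
  shows "bounded_loss \<rho> c"
proof
  have mono: "\<rho> x \<le> \<rho> y" if "0 \<le> x" "x \<le> y" "y \<le> c" for x y
    using strict_mono_onD[OF assms(5), of x y] that by (cases "x = y") (auto simp: less_imp_le)
  show "\<rho> x \<le> \<rho> y" if "0 \<le> x" "x \<le> y" for x y
  proof (cases "y \<le> c")
    case False
    then have "\<rho> y = \<rho> c" by (intro assms(3)) simp
    moreover have "\<rho> x \<le> \<rho> c"
      using mono[of x c] that(1) assms(3)[of x] by (cases "x \<le> c") auto
    ultimately show ?thesis by simp
  qed (rule mono[OF that])
  have "continuous_on {c..} \<rho>"
    by (rule continuous_on_eq[OF continuous_on_const[of _ "\<rho> c"]]) (rule assms(3)[symmetric], simp)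
  then have "continuous_on ({0..c} \<union> {c..}) \<rho>" by (intro continuous_on_closed_Un assms) auto
  moreover have "{0..c} \<union> {c..} = {0..}" using assms(2) by auto
  ultimately show "continuous_on {0..} \<rho>" by simp
  show "\<rho> x = \<rho> c" if "c \<le> x" for x using that by (rule assms(3))
qed (rule assms)+

section \<open>The breakdown point of the second stage\<close>

theorem theorem4:
  fixes P :: "('k::finite, 'q::finite) obs measure"
    and \<X> :: "(real ^ 'q ^ 'k) set"
    and \<Theta> :: "(real ^ 'l::finite) set"
    and V :: "real ^ 'l \<Rightarrow> real ^ 'k ^ 'k"
    and \<rho>\<^sub>0 \<rho>\<^sub>1 :: "real \<Rightarrow> real"
    and c\<^sub>0 c\<^sub>1 b\<^sub>0 r\<^sub>0 :: real
    and n :: nat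
    and S\<^sub>n :: "('k, 'q) obs list"
    and \<beta>\<^sub>0 \<beta>\<^sub>1 :: "('k, 'q) obs list \<Rightarrow> real ^ 'q"
    and \<theta>\<^sub>0 \<theta>\<^sub>1 \<gamma> :: "('k, 'q) obs list \<Rightarrow> real ^ 'l"
    and \<sigma> :: "('k, 'q) obs list \<Rightarrow> real"
  assumes "prob_space P" and "sets P = sets borel"
    and "design_space P \<X>"
    \<comment> \<open>the regression parameter is identifiable\<close>
    and "\<And>\<beta> \<beta>'. (AE s in P. snd s *v \<beta> = snd s *v \<beta>') \<Longrightarrow> \<beta> = \<beta>'"
    \<comment> \<open>covariance structure\<close>
    and "\<And>\<theta>. \<theta> \<in> \<Theta> \<Longrightarrow> pds (V \<theta>)"
    and "inj_on V \<Theta>"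
    and "continuous_on \<Theta> V"
    and "\<exists>\<theta>\<in>\<Theta>. V \<theta> = mat 1"
    and "\<And>\<theta> \<alpha>. \<theta> \<in> \<Theta> \<Longrightarrow> \<alpha> > 0 \<Longrightarrow> \<exists>\<theta>'\<in>\<Theta>. \<alpha> *\<^sub>R V \<theta> = V \<theta>'"
    and "\<And>B. bounded B \<Longrightarrow> bounded {\<theta> \<in> \<Theta>. V \<theta> \<in> B}"
    \<comment> \<open>initial loss function\<close>
    and "\<And>x. \<rho>\<^sub>0 x \<ge> 0" and "\<And>x. \<rho>\<^sub>0 (- x) = \<rho>\<^sub>0 x" and "\<rho>\<^sub>0 0 = 0" and "isCont \<rho>\<^sub>0 0"
    and "c\<^sub>0 > 0" and "\<And>x. x \<ge> c\<^sub>0 \<Longrightarrow> \<rho>\<^sub>0 x = \<rho>\<^sub>0 c\<^sub>0"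
    and "continuous_on {0..c\<^sub>0} \<rho>\<^sub>0" and "strict_mono_on {0..c\<^sub>0} \<rho>\<^sub>0"
    \<comment> \<open>second loss function; only its values on the nonnegative half-line matter\<close>
    and "\<And>x. \<rho>\<^sub>1 x \<ge> 0"
    and "c\<^sub>1 > 0" and "mono_on {0..c\<^sub>1} \<rho>\<^sub>1" and "\<And>x. x \<ge> c\<^sub>1 \<Longrightarrow> \<rho>\<^sub>1 x = \<rho>\<^sub>1 c\<^sub>1"
    and "0 < (SUP x\<in>{0..}. \<rho>\<^sub>1 x)"
    and "\<And>x. x \<ge> 0 \<Longrightarrow> \<rho>\<^sub>1 x / (SUP x\<in>{0..}. \<rho>\<^sub>1 x) \<le> \<rho>\<^sub>0 x / (SUP x. \<rho>\<^sub>0 x)"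
    \<comment> \<open>the sample\<close>
    and "S\<^sub>n \<in> samples n \<X>"
    and "0 < b\<^sub>0" and "b\<^sub>0 < (SUP x. \<rho>\<^sub>0 x)"
    and "r\<^sub>0 = b\<^sub>0 / (SUP x. \<rho>\<^sub>0 x)"
    and "0 < \<lfloor>real n * r\<^sub>0\<rfloor>" and "\<lfloor>real n * r\<^sub>0\<rfloor> < int n - int (kappa \<X> S\<^sub>n)"
    \<comment> \<open>the estimators\<close>
    and "\<And>S. S \<in> samples n \<X> \<Longrightarrow> \<theta>\<^sub>0 S \<in> \<Theta>"
    and "\<And>S. S \<in> samples n \<X> \<Longrightarrow> (\<beta>\<^sub>1 S, \<gamma> S) \<in> reg_shape_params V \<Theta>"
    and "\<And>S. S \<in> samples n \<X> \<Longrightarrow> \<theta>\<^sub>1 S \<in> \<Theta>"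
    \<comment> \<open>the defining requirements, at every sample for which the scale exists\<close>
    and "\<And>S. S \<in> samples n \<X> \<Longrightarrow> scale_solutions \<rho>\<^sub>0 b\<^sub>0 (\<beta>\<^sub>0 S) (shape V (\<theta>\<^sub>0 S)) S \<noteq> {} \<Longrightarrow>
          \<sigma> S \<in> scale_solutions \<rho>\<^sub>0 b\<^sub>0 (\<beta>\<^sub>0 S) (shape V (\<theta>\<^sub>0 S)) S \<and>
          mean_loss \<rho>\<^sub>1 (\<sigma> S) S (\<beta>\<^sub>1 S) (V (\<gamma> S))
            \<le> mean_loss \<rho>\<^sub>1 (\<sigma> S) S (\<beta>\<^sub>0 S) (shape V (\<theta>\<^sub>0 S)) \<and>
          V (\<theta>\<^sub>1 S) = (\<sigma> S)\<^sup>2 *\<^sub>R V (\<gamma> S)"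
  shows "breakdown_point n
           (\<lambda>m. reg_breaks \<X> \<beta>\<^sub>1 S\<^sub>n m \<or> cov_breaks \<X> V \<gamma> S\<^sub>n m \<or> cov_breaks \<X> V \<theta>\<^sub>1 S\<^sub>n m)
         \<ge> Min {breakdown_point n (\<lambda>m. reg_breaks \<X> \<beta>\<^sub>0 S\<^sub>n m \<or> cov_breaks \<X> V \<theta>\<^sub>0 S\<^sub>n m),
                ereal (\<lceil>real n * r\<^sub>0\<rceil> / real n),
                ereal ((\<lceil>real n - real n * r\<^sub>0\<rceil> - int (kappa \<X> S\<^sub>n)) / real n)}"
proof -
  have loss: "bounded_loss \<rho>\<^sub>0 c\<^sub>0" by (rule bounded_lossI) (rule assms(13,15,16,17,18); assumption?)+
  have \<rho>0_le: "\<rho>\<^sub>0 x \<le> \<rho>\<^sub>0 c\<^sub>0" for x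
    using bounded_loss.le_max[OF loss, of x] bounded_loss.le_max[OF loss, of "- x"] assms(12)[of x]
    by (cases "0 \<le> x") auto
  have s0: "(SUP x. \<rho>\<^sub>0 x) = \<rho>\<^sub>0 c\<^sub>0" by (rule SUP_saturated) (simp_all add: \<rho>0_le)
  have s1: "(SUP x\<in>{0..}. \<rho>\<^sub>1 x) = \<rho>\<^sub>1 c\<^sub>1"
  proof (rule SUP_saturated)
    show "\<rho>\<^sub>1 x \<le> \<rho>\<^sub>1 c\<^sub>1" if "x \<in> {0..}" for x
      using mono_onD[OF assms(21), of x c\<^sub>1] assms(22)[of x] that assms(20) by (cases "x \<le> c\<^sub>1") auto
  qed (use assms(20) in simp)
  have s0_pos: "0 < \<rho>\<^sub>0 c\<^sub>0" using assms(26,27) s0 by simp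
  have s1_pos: "0 < \<rho>\<^sub>1 c\<^sub>1" using assms(23) s1 by simp
  have cmp: "\<rho>\<^sub>1 x / \<rho>\<^sub>1 c\<^sub>1 \<le> \<rho>\<^sub>0 x / \<rho>\<^sub>0 c\<^sub>0" if "0 \<le> x" for x
    using assms(24)[OF that] by (simp only: s0 s1)
  have r0: "r\<^sub>0 = b\<^sub>0 / \<rho>\<^sub>0 c\<^sub>0" using assms(28) s0 by simp
  have n: "length S\<^sub>n = n" and Sn: "set S\<^sub>n \<subseteq> UNIV \<times> \<X>" using assms(25) by (auto simp: samples_def)
  have n_pos: "0 < n" using assms(29) by (cases "n = 0") auto
  have ne: "\<X> \<noteq> {}"
  proof -
    have "S\<^sub>n ! 0 \<in> UNIV \<times> \<X>" using Sn n n_pos nth_mem[of 0 S\<^sub>n] by (simp add: subset_eq)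
    then show ?thesis by auto
  qed
  have ident: "b = 0" if "\<And>X. X \<in> \<X> \<Longrightarrow> X *v b = 0" for b
    using assms(1,3,4) that by (rule design_space_identifies)
  obtain L where L: "0 < L"
    "\<And>J v \<beta> \<delta>. J \<subseteq> {..<length S\<^sub>n} \<Longrightarrow> kappa \<X> S\<^sub>n < card J \<Longrightarrow> 0 \<le> \<delta> \<Longrightarrow>
       (\<And>j. j \<in> J \<Longrightarrow> \<bar>v \<bullet> residual \<beta> (S\<^sub>n ! j)\<bar> \<le> \<delta>) \<Longrightarrow> norm v \<le> L * \<delta>"
    "\<And>J (\<beta> :: real ^ 'q) \<delta>. J \<subseteq> {..<length S\<^sub>n} \<Longrightarrow> kappa \<X> S\<^sub>n < card J \<Longrightarrow> 0 \<le> \<delta> \<Longrightarrow>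
       (\<And>j. j \<in> J \<Longrightarrow> norm (snd (S\<^sub>n ! j) *v \<beta>) \<le> \<delta>) \<Longrightarrow> norm \<beta> \<le> L * \<delta>"
    by (rule sample_constants[OF Sn ne ident, folded residual_def]) (assumption | blast)+
  \<comment> \<open>The contamination \<open>m\<close> is below all three terms of the minimum; no component breaks down.\<close>
  have main: "\<not> (reg_breaks \<X> \<beta>\<^sub>1 S\<^sub>n m \<or> cov_breaks \<X> V \<gamma> S\<^sub>n m \<or> cov_breaks \<X> V \<theta>\<^sub>1 S\<^sub>n m)"
    if few: "real m < real n * r\<^sub>0" and many: "real m + real (kappa \<X> S\<^sub>n) < real n - real n * r\<^sub>0"
      and \<beta>0: "\<not> reg_breaks \<X> \<beta>\<^sub>0 S\<^sub>n m" and \<theta>0: "\<not> cov_breaks \<X> V \<theta>\<^sub>0 S\<^sub>n m" for m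
  proof -
    interpret contaminated_sample \<rho>\<^sub>0 c\<^sub>0 \<X> S\<^sub>n m b\<^sub>0 L
    proof (intro contaminated_sample.intro contaminated_sample_axioms.intro loss)
      show "real m < real (length S\<^sub>n) * (b\<^sub>0 / \<rho>\<^sub>0 c\<^sub>0)"
        and "real m + real (kappa \<X> S\<^sub>n) < real (length S\<^sub>n) - real (length S\<^sub>n) * (b\<^sub>0 / \<rho>\<^sub>0 c\<^sub>0)"
        using few many by (simp_all add: n r0)
    qed (rule L assms(26) s0_pos; assumption)+
    let ?\<C> = "corrupted \<X> S\<^sub>n m"
    have samp: "S' \<in> samples n \<X>" if "S' \<in> ?\<C>" for S'
      using assms(25) that by (rule corrupted_in_samples)
    obtain B where B: "0 \<le> B" "\<And>S'. S' \<in> ?\<C> \<Longrightarrow> norm (\<beta>\<^sub>0 S') \<le> B"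
      using \<beta>0 unfolding not_reg_breaks_iff by blast
    obtain a A where aA: "0 < a" "\<And>S'. S' \<in> ?\<C> \<Longrightarrow> form_between a A (V (\<theta>\<^sub>0 S'))"
      using form_between_of_not_cov_breaks[OF \<theta>0 assms(5)[OF assms(31)[OF assms(25)]]
          assms(5)[OF assms(31)[OF samp]]] by metis
    \<comment> \<open>Bounds on the initial covariance matrices carry over to their shapes, and from these to the scale.\<close>
    obtain a\<^sub>0 A\<^sub>0 where aA0: "0 < a\<^sub>0" "\<And>C :: real ^ 'k ^ 'k. pds C \<Longrightarrow> form_between a A C \<Longrightarrow>
       form_between a\<^sub>0 A\<^sub>0 (inverse (det C powr (1 / real CARD('k))) *\<^sub>R C)"
      using form_between_scale_det[OF aA(1)] by metis
    have shape: "form_between a\<^sub>0 A\<^sub>0 (shape V (\<theta>\<^sub>0 S'))" "pds (shape V (\<theta>\<^sub>0 S'))" if "S' \<in> ?\<C>" for S'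
    proof -
      have pds: "pds (V (\<theta>\<^sub>0 S'))" by (rule assms(5)[OF assms(31)[OF samp[OF that]]])
      show "form_between a\<^sub>0 A\<^sub>0 (shape V (\<theta>\<^sub>0 S'))"
        unfolding shape_def by (rule aA0(2)[OF pds aA(2)[OF that]])
      show "pds (shape V (\<theta>\<^sub>0 S'))"
        unfolding shape_def using pds_det_pos[OF pds] by (intro pds_scaleR pds) simp
    qed
    obtain lo hi where lohi: "0 < lo" "0 < hi"
      "\<And>S' \<beta> C s. S' \<in> ?\<C> \<Longrightarrow> pds C \<Longrightarrow> form_between a\<^sub>0 A\<^sub>0 C \<Longrightarrow> norm \<beta> \<le> B \<Longrightarrow>
         s \<in> scale_solutions \<rho>\<^sub>0 b\<^sub>0 \<beta> C S' \<Longrightarrow> lo \<le> s \<and> s \<le> hi"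
      using scale_bounds[OF aA0(1) B(1)] by metis
    obtain a\<^sub>1 A\<^sub>1 K where fin: "0 < a\<^sub>1"
      "\<And>S' \<beta>\<^sub>0 C\<^sub>0 s \<beta> C. S' \<in> ?\<C> \<Longrightarrow> pds C\<^sub>0 \<Longrightarrow> s \<in> scale_solutions \<rho>\<^sub>0 b\<^sub>0 \<beta>\<^sub>0 C\<^sub>0 S' \<Longrightarrow>
       s \<le> hi \<Longrightarrow> pds C \<Longrightarrow> det C = 1 \<Longrightarrow>
       mean_loss \<rho>\<^sub>1 s S' \<beta> C \<le> mean_loss \<rho>\<^sub>1 s S' \<beta>\<^sub>0 C\<^sub>0 \<Longrightarrow> form_between a\<^sub>1 A\<^sub>1 C \<and> norm \<beta> \<le> K"
      using second_stage_bounds[OF lohi(2) assms(20,19,22) s1_pos cmp] by metis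
    have \<gamma>: "pds (V (\<gamma> S'))" "det (V (\<gamma> S')) = 1" if "S' \<in> ?\<C>" for S'
      using assms(32)[OF samp[OF that]] by (auto simp: reg_shape_params_def)
    have stage: "form_between a\<^sub>1 A\<^sub>1 (V (\<gamma> S')) \<and> norm (\<beta>\<^sub>1 S') \<le> K \<and>
        form_between (lo\<^sup>2 * a\<^sub>1) (hi\<^sup>2 * A\<^sub>1) (V (\<theta>\<^sub>1 S'))" if S': "S' \<in> ?\<C>" for S'
    proof -
      have \<sigma>: "\<sigma> S' \<in> scale_solutions \<rho>\<^sub>0 b\<^sub>0 (\<beta>\<^sub>0 S') (shape V (\<theta>\<^sub>0 S')) S'"
        and le: "mean_loss \<rho>\<^sub>1 (\<sigma> S') S' (\<beta>\<^sub>1 S') (V (\<gamma> S'))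
            \<le> mean_loss \<rho>\<^sub>1 (\<sigma> S') S' (\<beta>\<^sub>0 S') (shape V (\<theta>\<^sub>0 S'))"
        and \<theta>1: "V (\<theta>\<^sub>1 S') = (\<sigma> S')\<^sup>2 *\<^sub>R V (\<gamma> S')"
        using assms(34)[OF samp[OF S'] scale_solutions_nonempty[OF S' shape(2)[OF S']]] by simp_all
      have \<sigma>b: "lo \<le> \<sigma> S'" "\<sigma> S' \<le> hi"
        using lohi(3)[OF S' shape(2,1)[OF S'] B(2)[OF S'] \<sigma>] by simp_all
      have *: "form_between a\<^sub>1 A\<^sub>1 (V (\<gamma> S')) \<and> norm (\<beta>\<^sub>1 S') \<le> K"
        by (rule fin(2)[OF S' shape(2)[OF S'] \<sigma> \<sigma>b(2) \<gamma>[OF S'] le])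
      have "form_between (lo\<^sup>2 * a\<^sub>1) (hi\<^sup>2 * A\<^sub>1) ((\<sigma> S')\<^sup>2 *\<^sub>R V (\<gamma> S'))"
        using * \<sigma>b lohi(1) fin(1) by (intro form_between_scaleR[of a\<^sub>1 A\<^sub>1] power_mono) auto
      with * show ?thesis by (simp add: \<theta>1)
    qed
    have "\<not> reg_breaks \<X> \<beta>\<^sub>1 S\<^sub>n m"
      unfolding not_reg_breaks_iff
    proof (intro exI[of _ "max 0 K"] conjI ballI)
      fix S' assume "S' \<in> ?\<C>"
      from stage[OF this] show "norm (\<beta>\<^sub>1 S') \<le> max 0 K" by linarith
    qed simp
    moreover have "\<not> cov_breaks \<X> V \<gamma> S\<^sub>n m"
    proof (rule not_cov_breaks_of_form_between[OF fin(1)])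
      fix S' assume S': "S' \<in> ?\<C>"
      show "pds (V (\<gamma> S'))" by (rule \<gamma>(1)[OF S'])
      from stage[OF S'] show "form_between a\<^sub>1 A\<^sub>1 (V (\<gamma> S'))" by (rule conjunct1)
    qed
    moreover have "\<not> cov_breaks \<X> V \<theta>\<^sub>1 S\<^sub>n m"
    proof (rule not_cov_breaks_of_form_between)
      show "0 < lo\<^sup>2 * a\<^sub>1" using fin(1) lohi(1) by simp
      fix S' assume S': "S' \<in> ?\<C>"
      show "pds (V (\<theta>\<^sub>1 S'))" by (rule assms(5)[OF assms(33)[OF samp[OF S']]])
      from stage[OF S'] show "form_between (lo\<^sup>2 * a\<^sub>1) (hi\<^sup>2 * A\<^sub>1) (V (\<theta>\<^sub>1 S'))" by (elim conjE)
    qed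
    ultimately show ?thesis by simp
  qed
  show ?thesis
    unfolding breakdown_point_def[of n "\<lambda>m. reg_breaks \<X> \<beta>\<^sub>1 S\<^sub>n m \<or> cov_breaks \<X> V \<gamma> S\<^sub>n m \<or> cov_breaks \<X> V \<theta>\<^sub>1 S\<^sub>n m"]
  proof (rule Inf_greatest, clarify)
    fix m :: nat
    assume m: "1 \<le> m" "m \<le> n"
      and breaks: "reg_breaks \<X> \<beta>\<^sub>1 S\<^sub>n m \<or> cov_breaks \<X> V \<gamma> S\<^sub>n m \<or> cov_breaks \<X> V \<theta>\<^sub>1 S\<^sub>n m"
    let ?init = "breakdown_point n (\<lambda>m. reg_breaks \<X> \<beta>\<^sub>0 S\<^sub>n m \<or> cov_breaks \<X> V \<theta>\<^sub>0 S\<^sub>n m)"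
    have le: "x \<le> y \<Longrightarrow> x / real n \<le> y / real n" for x y by (rule divide_right_mono) simp_all
    let ?breaks\<^sub>0 = "reg_breaks \<X> \<beta>\<^sub>0 S\<^sub>n m \<or> cov_breaks \<X> V \<theta>\<^sub>0 S\<^sub>n m"
    have "?breaks\<^sub>0 \<or> real n * r\<^sub>0 \<le> real m \<or> real n - real n * r\<^sub>0 \<le> real m + real (kappa \<X> S\<^sub>n)"
    proof (rule ccontr)
      assume "\<not> ?thesis"
      then have "real m < real n * r\<^sub>0" "real m + real (kappa \<X> S\<^sub>n) < real n - real n * r\<^sub>0"
        and "\<not> reg_breaks \<X> \<beta>\<^sub>0 S\<^sub>n m" "\<not> cov_breaks \<X> V \<theta>\<^sub>0 S\<^sub>n m" by (auto simp: not_le)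
      from main[OF this] breaks show False by contradiction
    qed
    then have "?init \<le> ereal (real m / real n) \<or> ereal (\<lceil>real n * r\<^sub>0\<rceil> / real n) \<le> ereal (real m / real n)
        \<or> ereal ((\<lceil>real n - real n * r\<^sub>0\<rceil> - int (kappa \<X> S\<^sub>n)) / real n) \<le> ereal (real m / real n)"
    proof (elim disjE)
      assume "reg_breaks \<X> \<beta>\<^sub>0 S\<^sub>n m"
      then have "?init \<le> ereal (real m / real n)" by (intro breakdown_point_le m) simp
      then show ?thesis by (rule disjI1)
    next
      assume "cov_breaks \<X> V \<theta>\<^sub>0 S\<^sub>n m"
      then have "?init \<le> ereal (real m / real n)" by (intro breakdown_point_le m) simp
      then show ?thesis by (rule disjI1)
    next
      assume "real n * r\<^sub>0 \<le> real m"
      then have "\<lceil>real n * r\<^sub>0\<rceil> \<le> int m" by (simp add: ceiling_le_iff)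
      then show ?thesis by (simp add: le)
    next
      assume "real n - real n * r\<^sub>0 \<le> real m + real (kappa \<X> S\<^sub>n)"
      then have "\<lceil>real n - real n * r\<^sub>0\<rceil> \<le> int m + int (kappa \<X> S\<^sub>n)" by (simp add: ceiling_le_iff)
      then have "real_of_int (\<lceil>real n - real n * r\<^sub>0\<rceil> - int (kappa \<X> S\<^sub>n)) \<le> real m" by linarith
      then show ?thesis by (simp add: le)
    qed
    then show "Min {?init, ereal (\<lceil>real n * r\<^sub>0\<rceil> / real n),
        ereal ((\<lceil>real n - real n * r\<^sub>0\<rceil> - int (kappa \<X> S\<^sub>n)) / real n)} \<le> ereal (real m / real n)"
      by (auto simp: min_le_iff_disj)
  qed
qed

end
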